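(* Let $\kappa$ and $\lambda$ be uncountable cardinals, and suppose there exists a $(\kappa,\lambda)$-witness $\langle T_{\alpha,n}:\alpha\in\lambda,\ n\in\omega\rangle$. Let ${}^*V$ be a nonstandard universe which is $\kappa$-saturated, and let $(\Omega,\Sigma,L_P)$ be a hyperfinite Loeb space in ${}^*V$ such that $|{}^*\mathcal{P}(\Omega)|=\lambda$. Then $\Omega$ is compact.
   Context: Work in ZFC. The standard universe $V$ is built over $\mathbb{N}$ as urelements: $V_0=\mathbb{N}$, $V_{n+1}=V_n\cup\mathcal{P}(V_n)$, $V=\bigcup_n V_n$. A nonstandard universe ${}^*V$ is the truncation at ${}^*\!\in$-rank $\omega$ of an elementary extension of $(V,\in)$ with ${}^*\mathbb{N}\setminus\mathbb{N}\neq\emptyset$; it is always assumed to be at least $\omega_1$-saturated. For an internal set $\Omega$, ${}^*\mathcal{P}(\Omega)$ denotes the set of internal subsets of $\Omega$. A hyperfinite Loeb space: fix $H\in{}^*\mathbb{N}\setminus\mathbb{N}$, $\Omega=\{1,\dots,H\}$, $P(A)={}^*|A|/H$ for $A\in{}^*\mathcal{P}(\Omega)$ (internal cardinality); $(\Omega,\Sigma,L_P)$ is the Loeb space, i.e. $\Sigma$ is the $\sigma$-algebra generated by ${}^*\mathcal{P}(\Omega)$ completed with respect to the unique countably additive extension $L_P$ of $\mathrm{st}\circ P$. $|\Omega|$ is the external (set-theoretic) cardinality. A family $\mathcal{C}\subseteq\Sigma$ is compact if every $\mathcal{D}\subseteq\mathcal{C}$ with the finite intersection property has $\bigcap\mathcal{D}\neq\emptyset$;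 it is inner-regular if $L_P(A)=\sup\{L_P(C):C\subseteq A,\ C\in\mathcal{C}\}$ for all $A\in\Sigma$. The space $\Omega$ is compact if there is an inner-regular compact family on it. Let $\nu_\omega$ be the standard product (coin-tossing) probability measure on ${}^\omega 2$. A tree $T\subseteq{}^{<\omega}2$ is a set closed under initial segments with no maximal node; $[T]$ is its set of infinite branches. A sequence of trees $\langle T_{\alpha,n}:\alpha\in\lambda,\ n\in\omega\rangle$ is a $(\kappa,\lambda)$-witness if (1) $\nu_\omega([T_{\alpha,n}])>\frac{n}{n+1}$ for all $\alpha,n$, and (2) for every $f\in{}^\omega 2$, $|\{\alpha\in\lambda:\exists n\,(f\in[T_{\alpha,n}])\}|<\kappa$. *)

theory Defs
  imports "HOL-Probability.Probability" "HOL-Library.Sublist"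
begin

unbundle cardinal_syntax

section \<open>First-order logic of one binary relation\<close>

datatype fm = Mem nat nat | Eq nat nat | Neg fm | Conj fm fm | Ex nat fm

primrec sat :: "('a \<Rightarrow> 'a \<Rightarrow> bool) \<Rightarrow> (nat \<Rightarrow> 'a) \<Rightarrow> fm \<Rightarrow> bool" where
  "sat E e (Mem i j) \<longleftrightarrow> E (e i) (e j)"
| "sat E e (Eq i j) \<longleftrightarrow> e i = e j"
| "sat E e (Neg \<phi>) \<longleftrightarrow> \<not> sat E e \<phi>"
| "sat E e (Conj \<phi> \<psi>) \<longleftrightarrow> sat E e \<phi> \<and> sat E e \<psi>"
| "sat E e (Ex i \<phi>) \<longleftrightarrow> (\<exists>x. sat E (e(i := x)) \<phi>)"

definition elementary_embedding ::
  "('a \<Rightarrow> 'a \<Rightarrow> bool) \<Rightarrow> ('b \<Rightarrow> 'b \<Rightarrow> bool) \<Rightarrow> ('a \<Rightarrow> 'b) \<Rightarrow> bool" where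
  "elementary_embedding E F j \<longleftrightarrow> (\<forall>\<phi> e. sat E e \<phi> \<longleftrightarrow> sat F (j \<circ> e) \<phi>)"


section \<open>The standard universe\<close>

text \<open>The elements of rank at most \<open>n\<close> over a set \<open>U\<close> of urelements.\<close>

primrec level :: "('a \<Rightarrow> 'a \<Rightarrow> bool) \<Rightarrow> 'a set \<Rightarrow> nat \<Rightarrow> 'a set" where
  "level E U 0 = U"
| "level E U (Suc n) = level E U n \<union> {x. \<forall>y. E y x \<longrightarrow> y \<in> level E U n}"

text \<open>Kuratowski pairs: \<open>p = {{a}, {a, b}}\<close>.\<close>

definition is_pair :: "('a \<Rightarrow> 'a \<Rightarrow> bool) \<Rightarrow> 'a \<Rightarrow> 'a \<Rightarrow> 'a \<Rightarrow> bool" where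
  "is_pair E p a b \<longleftrightarrow> (\<exists>s t. (\<forall>z. E z s \<longleftrightarrow> z = a) \<and> (\<forall>z. E z t \<longleftrightarrow> z = a \<or> z = b)
     \<and> (\<forall>z. E z p \<longleftrightarrow> z = s \<or> z = t))"

text \<open>The superstructure over the natural numbers has \<open>\<beth>\<^sub>\<omega>\<close> many elements, so
  no type that HOL constructs can carry it. It is therefore axiomatised, up to unique
  isomorphism: the type \<open>'v\<close> is the universe, \<open>num n\<close> is the urelement \<open>n\<close>,
  and \<open>full\<close> together with \<open>extensional\<close> makes \<open>level mem (range num) (Suc n)\<close>
  the union of level \<open>n\<close> and its full power set.\<close>

locale standard_universe =
  fixes mem :: "'v \<Rightarrow> 'v \<Rightarrow> bool" and num :: "nat \<Rightarrow> 'v"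
  assumes inj_num: "inj num"
    and urelement: "\<And>x n. \<not> mem x (num n)"
    and extensional: "\<And>x y. x \<notin> range num \<Longrightarrow> y \<notin> range num \<Longrightarrow>
          (\<And>z. mem z x \<longleftrightarrow> mem z y) \<Longrightarrow> x = y"
    and full: "\<And>n A. A \<subseteq> level mem (range num) n \<Longrightarrow>
          \<exists>x. x \<notin> range num \<and> (\<forall>z. mem z x \<longleftrightarrow> z \<in> A)"
    and finite_rank: "(\<Union>n. level mem (range num) n) = UNIV"
begin

text \<open>The element of the universe with extension \<open>A\<close>; meaningful only when \<open>A\<close> is
  contained in some level.\<close>

definition set_code :: "'v set \<Rightarrow> 'v" where
  "set_code A = (THE x. x \<notin> range num \<and> (\<forall>z. mem z x \<longleftrightarrow> z \<in> A))"

definition rel_code :: "('v \<Rightarrow> 'v \<Rightarrow> bool) \<Rightarrow> 'v" where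
  "rel_code R = set_code {p. \<exists>x y. is_pair mem p x y \<and> R x y}"

text \<open>A relation on the natural numbers, as a relation on the universe.\<close>

definition num_rel :: "(nat \<Rightarrow> nat \<Rightarrow> bool) \<Rightarrow> 'v \<Rightarrow> 'v \<Rightarrow> bool" where
  "num_rel Q x y \<longleftrightarrow> (\<exists>m n. x = num m \<and> y = num n \<and> Q m n)"

text \<open>The graph of cardinality on the finite sets of natural numbers.\<close>

definition card_rel :: "'v \<Rightarrow> 'v \<Rightarrow> bool" where
  "card_rel x y \<longleftrightarrow> (\<exists>S. finite S \<and> x = set_code (num ` S) \<and> y = num (card S))"

end


section \<open>Nonstandard universes\<close>

text \<open>The finite intersection property.\<close>

definition fip :: "'a set set \<Rightarrow> bool" where
  "fip D \<longleftrightarrow> (\<forall>F. F \<subseteq> D \<and> finite F \<and> F \<noteq> {} \<longrightarrow> \<Inter>F \<noteq> {})"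

text \<open>\<open>smem\<close> is the membership relation of an elementary extension of the standard
  universe, which need not be well-founded, and \<open>star\<close> is the embedding.\<close>

locale elementary_extension = standard_universe mem num
  for mem :: "'v \<Rightarrow> 'v \<Rightarrow> bool" and num :: "nat \<Rightarrow> 'v" +
  fixes smem :: "'w \<Rightarrow> 'w \<Rightarrow> bool" and star :: "'v \<Rightarrow> 'w"
  assumes elementary: "elementary_embedding mem smem star"
begin

definition star_N :: "'w set" where
  "star_N = {x. smem x (star (set_code (range num)))}"

definition standard_N :: "'w set" where
  "standard_N = range (star \<circ> num)"

text \<open>The truncation of the extension at rank \<open>\<omega>\<close> over the hypernaturals.\<close>

definition star_V :: "'w set" where
  "star_V = (\<Union>n. level smem star_N n)"

definition internal :: "'w set \<Rightarrow> bool" where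
  "internal A \<longleftrightarrow> (\<exists>x\<in>star_V. A = {y. smem y x})"

definition star_Pow :: "'w set \<Rightarrow> 'w set set" where
  "star_Pow \<Omega> = {A. internal A \<and> A \<subseteq> \<Omega>}"

definition saturated :: "'k rel \<Rightarrow> bool" where
  "saturated \<kappa> \<longleftrightarrow> (\<forall>D. (\<forall>A\<in>D. internal A) \<and> |D| <o \<kappa> \<and> fip D \<longrightarrow> \<Inter>D \<noteq> {})"

text \<open>The extension of a binary relation, as a relation on the nonstandard universe.\<close>

definition star_rel :: "('v \<Rightarrow> 'v \<Rightarrow> bool) \<Rightarrow> 'w \<Rightarrow> 'w \<Rightarrow> bool" where
  "star_rel R a b \<longleftrightarrow> (\<exists>p. is_pair smem p a b \<and> smem p (star (rel_code R)))"

text \<open>Internal cardinality: the extension of the function \<open>card\<close> on finite sets of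
  natural numbers.\<close>

definition internal_card :: "'w set \<Rightarrow> 'w" where
  "internal_card A = (THE k. \<exists>a. {y. smem y a} = A \<and> star_rel card_rel a k)"

text \<open>The standard part of the quotient of two hypernaturals: the real number \<open>r\<close> such
  that \<open>\<bar>a / b - r\<bar> < \<epsilon>\<close> holds in the extension for every standard \<open>\<epsilon> > 0\<close>.\<close>

definition st_quotient :: "'w \<Rightarrow> 'w \<Rightarrow> real" where
  "st_quotient a b =
     (THE r. \<forall>\<epsilon>>0. star_rel (num_rel (\<lambda>m n. \<bar>real m / real n - r\<bar> < \<epsilon>)) a b)"

text \<open>The interval \<open>{1, \<dots>, H}\<close> of hypernaturals.\<close>

definition hyperfinite :: "'w \<Rightarrow> 'w set" where
  "hyperfinite H = {k. star_rel (num_rel (\<lambda>m n. 1 \<le> m \<and> m \<le> n)) k H}"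

definition loeb :: "'w \<Rightarrow> 'w measure" where
  "loeb H = completion (extend_measure (hyperfinite H) (star_Pow (hyperfinite H)) (\<lambda>A. A)
     (\<lambda>A. ennreal (st_quotient (internal_card A) H)))"

end

locale nonstandard_universe = elementary_extension mem num smem star
  for mem :: "'v \<Rightarrow> 'v \<Rightarrow> bool" and num :: "nat \<Rightarrow> 'v"
    and smem :: "'w \<Rightarrow> 'w \<Rightarrow> bool" and star :: "'v \<Rightarrow> 'w" +
  assumes nonstandard: "star_N - standard_N \<noteq> {}"
    and omega1_saturated: "saturated (cardSuc natLeq)"


section \<open>Compact measure spaces\<close>

definition compact_family :: "'a set set \<Rightarrow> bool" where
  "compact_family C \<longleftrightarrow> (\<forall>D. D \<subseteq> C \<and> fip D \<longrightarrow> \<Inter>D \<noteq> {})"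

definition inner_regular_family :: "'a measure \<Rightarrow> 'a set set \<Rightarrow> bool" where
  "inner_regular_family M C \<longleftrightarrow>
     (\<forall>A\<in>sets M. emeasure M A = (SUP K\<in>{K\<in>C. K \<subseteq> A}. emeasure M K))"

definition compact_measure_space :: "'a measure \<Rightarrow> bool" where
  "compact_measure_space M \<longleftrightarrow>
     (\<exists>C. C \<subseteq> sets M \<and> compact_family C \<and> inner_regular_family M C)"


section \<open>Witnesses\<close>

definition coin_measure :: "(nat \<Rightarrow> bool) measure" where
  "coin_measure = (\<Pi>\<^sub>M i\<in>UNIV. measure_pmf (bernoulli_pmf (1/2)))"

definition tree :: "bool list set \<Rightarrow> bool" where
  "tree T \<longleftrightarrow> (\<forall>t\<in>T. \<forall>s. prefix s t \<longrightarrow> s \<in> T) \<and> (\<forall>s\<in>T. \<exists>t\<in>T. strict_prefix s t)"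

definition branches :: "bool list set \<Rightarrow> (nat \<Rightarrow> bool) set" where
  "branches T = {f. \<forall>n. map f [0..<n] \<in> T}"

text \<open>Cardinals are represented by cardinal orders, and \<open>\<alpha> \<in> \<lambda>\<close> by \<open>\<alpha> \<in> Field \<lambda>\<close>.\<close>

definition witness :: "'k rel \<Rightarrow> 'l rel \<Rightarrow> ('l \<Rightarrow> nat \<Rightarrow> bool list set) \<Rightarrow> bool" where
  "witness \<kappa> lam T \<longleftrightarrow>
     (\<forall>\<alpha>\<in>Field lam. \<forall>n. tree (T \<alpha> n)) \<and>
     (\<forall>\<alpha>\<in>Field lam. \<forall>n. measure coin_measure (branches (T \<alpha> n)) > real n / real (n + 1)) \<and>
     (\<forall>f. |{\<alpha>\<in>Field lam. \<exists>n. f \<in> branches (T \<alpha> n)}| <o \<kappa>)"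

end

(* Read the binary digits of a hypernatural x in Omega as a point "digits x" of Cantor space.
   Because H is infinite, residue classes modulo 2^k have Loeb measure 2^-k, so the preimage of a
   closed set [T] has Loeb measure at least its coin-tossing measure. Enumerate the internal sets
   as A_alpha and put cell alpha n = {x in A_alpha. digits x in [T_(alpha,n)]}: these sets
   exhaust A_alpha in measure. If a set of cells has the finite intersection property, then
   compactness of Cantor space gives one f in all the closed sets [T_(alpha,n)] involved, so by the
   witness property fewer than kappa many cells are involved, and kappa-saturation, applied to the
   internal sets {x in A_alpha. digits x restricted to k lies in T_(alpha,n)}, gives a common point.
   Compactness survives closing the family under countable intersections, and the countable
   intersections of internal sets approximate every Loeb measurable set from inside. *)
theory Submission
  imports Defs
begin

section \<open>Transfer\<close>

definition fAll :: "nat \<Rightarrow> fm \<Rightarrow> fm" where "fAll i \<phi> = Neg (Ex i (Neg \<phi>))"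
definition fOr :: "fm \<Rightarrow> fm \<Rightarrow> fm" where "fOr \<phi> \<psi> = Neg (Conj (Neg \<phi>) (Neg \<psi>))"
definition fImp :: "fm \<Rightarrow> fm \<Rightarrow> fm" where "fImp \<phi> \<psi> = Neg (Conj \<phi> (Neg \<psi>))"
definition fIff :: "fm \<Rightarrow> fm \<Rightarrow> fm" where "fIff \<phi> \<psi> = Conj (fImp \<phi> \<psi>) (fImp \<psi> \<phi>)"

lemma sat_connectives [simp]:
  "sat E e (fAll i \<phi>) \<longleftrightarrow> (\<forall>x. sat E (e(i := x)) \<phi>)"
  "sat E e (fOr \<phi> \<psi>) \<longleftrightarrow> sat E e \<phi> \<or> sat E e \<psi>"
  "sat E e (fImp \<phi> \<psi>) \<longleftrightarrow> (sat E e \<phi> \<longrightarrow> sat E e \<psi>)"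
  "sat E e (fIff \<phi> \<psi>) \<longleftrightarrow> (sat E e \<phi> \<longleftrightarrow> sat E e \<psi>)"
  by (auto simp: fAll_def fOr_def fImp_def fIff_def)

text \<open>An element is read as a set of Kuratowski pairs. \<open>star_rel R\<close> is the
  instance at \<open>star (rel_code R)\<close>, so the same formula \<open>fRel\<close> describes
  both sides of a transfer.\<close>

definition related :: "('a \<Rightarrow> 'a \<Rightarrow> bool) \<Rightarrow> 'a \<Rightarrow> 'a \<Rightarrow> 'a \<Rightarrow> bool" where
  "related E r a b \<longleftrightarrow> (\<exists>p. is_pair E p a b \<and> E p r)"

text \<open>The variables from 96 on are reserved for the quantifiers hidden in the next two formulas.\<close>

definition fPair :: "nat \<Rightarrow> nat \<Rightarrow> nat \<Rightarrow> fm" where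
  "fPair p a b = Ex 97 (Ex 98
     (Conj (fAll 99 (fIff (Mem 99 97) (Eq 99 a)))
     (Conj (fAll 99 (fIff (Mem 99 98) (fOr (Eq 99 a) (Eq 99 b))))
           (fAll 99 (fIff (Mem 99 p) (fOr (Eq 99 97) (Eq 99 98)))))))"

definition fRel :: "nat \<Rightarrow> nat \<Rightarrow> nat \<Rightarrow> fm" where
  "fRel r a b = Ex 96 (Conj (fPair 96 a b) (Mem 96 r))"

text \<open>The bound is 97 and not 96 because \<open>fRel\<close> applies \<open>fPair\<close> to
  its own bound variable 96.\<close>

lemma sat_fPair:
  "p < 97 \<Longrightarrow> a < 97 \<Longrightarrow> b < 97 \<Longrightarrow> sat E e (fPair p a b) \<longleftrightarrow> is_pair E (e p) (e a) (e b)"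
  by (simp add: fPair_def is_pair_def)

lemma sat_fRel [simp]:
  "r < 96 \<Longrightarrow> a < 96 \<Longrightarrow> b < 96 \<Longrightarrow> sat E e (fRel r a b) \<longleftrightarrow> related E (e r) (e a) (e b)"
  by (simp add: fRel_def related_def sat_fPair)

section \<open>Coding of pairs, relations and finite cardinality in the standard universe\<close>

context standard_universe
begin

abbreviation lev :: "nat \<Rightarrow> 'v set" where "lev \<equiv> level mem (range num)"

lemma level_mono: "m \<le> n \<Longrightarrow> lev m \<subseteq> lev n"
  by (induction n) (auto simp: le_Suc_eq)

lemma level_transitive: "x \<in> lev n \<Longrightarrow> mem y x \<Longrightarrow> y \<in> lev n"
  by (induction n) (use urelement in auto)

lemma ex_level: "\<exists>n. x \<in> lev n"
  using finite_rank by blast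

lemma ex_level2: "\<exists>n. x \<in> lev n \<and> y \<in> lev n"
proof -
  obtain m n where "x \<in> lev m" "y \<in> lev n"
    using ex_level by meson
  then show ?thesis
    using level_mono[of m "max m n"] level_mono[of n "max m n"] by auto
qed

lemma num_level [simp]: "num k \<in> lev n"
  using level_mono[of 0 n] by auto

lemma set_code:
  assumes "A \<subseteq> lev n"
  shows "set_code A \<notin> range num" and "mem z (set_code A) \<longleftrightarrow> z \<in> A"
proof -
  obtain x where x: "x \<notin> range num \<and> (\<forall>z. mem z x \<longleftrightarrow> z \<in> A)"
    using full[OF assms] by blast
  have "set_code A \<notin> range num \<and> (\<forall>z. mem z (set_code A) \<longleftrightarrow> z \<in> A)"
    unfolding set_code_def using x by (rule theI) (metis extensional x)
  then show "set_code A \<notin> range num" and "mem z (set_code A) \<longleftrightarrow> z \<in> A"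
    by blast+
qed

lemma ex_is_pair: "\<exists>p. is_pair mem p a b"
proof -
  obtain n where n: "a \<in> lev n" "b \<in> lev n"
    using ex_level2 by blast
  have 1: "{a} \<subseteq> lev n" "{a, b} \<subseteq> lev n"
    using n by auto
  have 2: "{set_code {a}, set_code {a, b}} \<subseteq> lev (Suc n)"
    using n by (auto simp: set_code(2)[OF 1(1)] set_code(2)[OF 1(2)])
  show ?thesis
    unfolding is_pair_def
    by (rule exI[of _ "set_code {set_code {a}, set_code {a, b}}"],
        rule exI[of _ "set_code {a}"], rule exI[of _ "set_code {a, b}"])
       (simp add: set_code(2)[OF 1(1)] set_code(2)[OF 1(2)] set_code(2)[OF 2])
qed

lemma is_pair_inject:
  assumes "is_pair mem p a b" "is_pair mem p c d"
  shows "a = c \<and> b = d"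
proof -
  obtain s t where 1: "\<forall>z. mem z s \<longleftrightarrow> z = a" "\<forall>z. mem z t \<longleftrightarrow> z = a \<or> z = b"
      "\<forall>z. mem z p \<longleftrightarrow> z = s \<or> z = t"
    using assms(1) unfolding is_pair_def by blast
  obtain u v where 2: "\<forall>z. mem z u \<longleftrightarrow> z = c" "\<forall>z. mem z v \<longleftrightarrow> z = c \<or> z = d"
      "\<forall>z. mem z p \<longleftrightarrow> z = u \<or> z = v"
    using assms(2) unfolding is_pair_def by blast
  have "(s = u \<or> s = v) \<and> (t = u \<or> t = v) \<and> (u = s \<or> u = t) \<and> (v = s \<or> v = t)"
    using 1(3) 2(3) by metis
  then show ?thesis
    using 1(1,2) 2(1,2) by metis
qed

lemma is_pair_level:
  assumes "is_pair mem p a b" "a \<in> lev n" "b \<in> lev n"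
  shows "p \<in> lev (Suc (Suc n))"
  using assms unfolding is_pair_def by auto

text \<open>The pairs of such a relation lie in one level, two above the bound, so
  \<open>set_code\<close> is meaningful for the set of them.\<close>

definition bounded_rel :: "('v \<Rightarrow> 'v \<Rightarrow> bool) \<Rightarrow> bool" where
  "bounded_rel R \<longleftrightarrow> (\<exists>n. \<forall>x y. R x y \<longrightarrow> x \<in> lev n \<and> y \<in> lev n)"

text \<open>This evaluates the standard side of a transfer: a formula about the code of
  \<open>R\<close> becomes a statement about \<open>R\<close> itself.\<close>

lemma related_rel_code:
  assumes "bounded_rel R"
  shows "related mem (rel_code R) = R"
proof (intro ext)
  fix a b
  obtain n where n: "\<And>x y. R x y \<Longrightarrow> x \<in> lev n \<and> y \<in> lev n"
    using assms unfolding bounded_rel_def by blast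
  have "{p. \<exists>x y. is_pair mem p x y \<and> R x y} \<subseteq> lev (Suc (Suc n))"
    using is_pair_level n by blast
  then have "related mem (rel_code R) a b \<longleftrightarrow> (\<exists>p. is_pair mem p a b \<and> (\<exists>x y. is_pair mem p x y \<and> R x y))"
    unfolding related_def rel_code_def by (simp only: set_code(2) mem_Collect_eq)
  then show "related mem (rel_code R) a b = R a b"
    using is_pair_inject ex_is_pair by metis
qed

lemma nums_level: "num ` S \<subseteq> lev n"
  by auto

lemma mem_set_code_nums [simp]: "mem z (set_code (num ` S)) \<longleftrightarrow> z \<in> num ` S"
  by (rule set_code(2)[OF nums_level])

lemma bounded_num_rel: "bounded_rel (num_rel Q)"
  unfolding bounded_rel_def num_rel_def by (rule exI[of _ 0]) auto

lemma bounded_card_rel: "bounded_rel card_rel"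
  unfolding bounded_rel_def card_rel_def by (rule exI[of _ 1]) auto

lemmas related_num_rel = related_rel_code[OF bounded_num_rel]
lemmas related_card_rel = related_rel_code[OF bounded_card_rel]

lemma num_rel_num [simp]: "num_rel Q (num m) (num n) \<longleftrightarrow> Q m n"
  using inj_num by (auto simp: num_rel_def dest: injD)

lemma num_eq_num [simp]: "num m = num n \<longleftrightarrow> m = n"
  using inj_num by (auto dest: injD)

lemma ex_Diff: "\<exists>z. \<forall>w. mem w z \<longleftrightarrow> mem w x \<and> \<not> mem w y"
proof -
  obtain n where "x \<in> lev n"
    using ex_level by blast
  then have "{w. mem w x \<and> \<not> mem w y} \<subseteq> lev n"
    using level_transitive by blast
  from full[OF this] show ?thesis
    by auto
qed

lemma ex_section: "\<exists>z. \<forall>w. mem w z \<longleftrightarrow> num_rel Q w h"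
proof -
  have "{w. num_rel Q w h} \<subseteq> lev 0"
    by (auto simp: num_rel_def)
  from full[OF this] show ?thesis
    by auto
qed

lemma card_rel_num_image: "finite S \<Longrightarrow> card_rel (set_code (num ` S)) (num (card S))"
  unfolding card_rel_def by blast

text \<open>Equality of members is assumed in place of \<open>x = y\<close> because
  \<open>internal_card\<close> sees only the extension of a set.\<close>

lemma card_rel_determined:
  assumes "card_rel x k" "card_rel y l" "\<And>z. mem z x \<longleftrightarrow> mem z y"
  shows "k = l"
proof -
  obtain S S' where S: "x = set_code (num ` S)" "k = num (card S)"
      "y = set_code (num ` S')" "l = num (card S')"
    using assms(1,2) unfolding card_rel_def by blast
  then have "num ` S = num ` S'"
    using assms(3) by auto
  then show ?thesis
    using S inj_num by (simp add: inj_image_eq_iff)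
qed

end

section \<open>Transfer to the extension, hypernaturals and internal sets\<close>

context elementary_extension
begin

text \<open>The list holds the parameters as variables 0, 1, and so on; quantified variables start
  at 10. Entries beyond the list are unspecified, but the formulas below have no such variable
  free.\<close>

lemma transfer: "sat mem (\<lambda>i. xs ! i) \<phi> \<Longrightarrow> sat smem (\<lambda>i. star (xs ! i)) \<phi>"
  using elementary unfolding elementary_embedding_def by (simp add: comp_def)

lemma star_rel_iff: "star_rel R a b \<longleftrightarrow> related smem (star (rel_code R)) a b"
  by (simp add: star_rel_def related_def)

text \<open>For fixed hypernaturals \<open>a\<close> and \<open>b\<close>, the relations \<open>Q\<close> with \<open>hrel Q a b\<close> form an
  ultrafilter.\<close>

abbreviation hrel :: "(nat \<Rightarrow> nat \<Rightarrow> bool) \<Rightarrow> 'w \<Rightarrow> 'w \<Rightarrow> bool" where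
  "hrel Q \<equiv> star_rel (num_rel Q)"

text \<open>Closure of the ultrafilter under intersections and supersets in one rule: an inference
  about hypernaturals is reduced to one about natural numbers.\<close>

lemma hrel_resolve:
  assumes "hrel P a b" "hrel Q a b" "\<And>m n. P m n \<Longrightarrow> Q m n \<Longrightarrow> R m n"
  shows "hrel R a b"
proof -
  have "sat smem (\<lambda>i. star ([rel_code (num_rel P), rel_code (num_rel Q), rel_code (num_rel R)] ! i))
     (fAll 10 (fAll 11 (fImp (Conj (fRel 0 10 11) (fRel 1 10 11)) (fRel 2 10 11))))"
    by (rule transfer) (use assms(3) in \<open>auto simp: related_num_rel num_rel_def\<close>)
  then show ?thesis
    using assms(1,2) by (simp add: star_rel_iff)
qed

lemma hrel_mono: "hrel P a b \<Longrightarrow> (\<And>m n. P m n \<Longrightarrow> Q m n) \<Longrightarrow> hrel Q a b"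
  by (rule hrel_resolve)

lemma hrel_False: "\<not> hrel (\<lambda>m n. False) a b"
proof -
  have "sat smem (\<lambda>i. star ([rel_code (num_rel (\<lambda>m n. False))] ! i))
     (fAll 10 (fAll 11 (Neg (fRel 0 10 11))))"
    by (rule transfer) (simp add: related_num_rel num_rel_def)
  then show ?thesis
    by (simp add: star_rel_iff)
qed

lemma hrel_star_N:
  assumes "hrel Q a b" shows "a \<in> star_N" "b \<in> star_N"
proof -
  have "sat smem (\<lambda>i. star ([rel_code (num_rel Q), set_code (range num)] ! i))
     (fAll 10 (fAll 11 (fImp (fRel 0 10 11) (Conj (Mem 10 1) (Mem 11 1)))))"
    by (rule transfer) (auto simp add: related_num_rel num_rel_def)
  then show "a \<in> star_N" "b \<in> star_N"
    using assms by (simp_all add: star_rel_iff star_N_def)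
qed

text \<open>Maximality of the ultrafilter. Outside \<open>star_N\<close> both relations fail, by
  \<open>hrel_star_N\<close>.\<close>

lemma hrel_not:
  assumes "a \<in> star_N" "b \<in> star_N"
  shows "hrel (\<lambda>m n. \<not> Q m n) a b \<longleftrightarrow> \<not> hrel Q a b"
proof -
  have "sat smem (\<lambda>i. star ([rel_code (num_rel Q), set_code (range num), rel_code (num_rel (\<lambda>m n. \<not> Q m n))] ! i))
     (fAll 10 (fAll 11 (fImp (Conj (Mem 10 1) (Mem 11 1)) (fIff (fRel 2 10 11) (Neg (fRel 0 10 11))))))"
    by (rule transfer) (auto simp add: related_num_rel)
  then show ?thesis
    using assms by (simp add: star_rel_iff star_N_def)
qed

lemma hrel_True: "a \<in> star_N \<Longrightarrow> b \<in> star_N \<Longrightarrow> hrel (\<lambda>m n. True) a b"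
  using hrel_not[of a b "\<lambda>m n. False"] hrel_False by simp

text \<open>A property of one hypernatural is expressed by a binary relation with the argument
  repeated.\<close>

lemma hrel_const:
  assumes "a \<in> star_N"
  shows "hrel (\<lambda>m n. m = c) a a \<longleftrightarrow> a = star (num c)"
proof -
  have "sat smem (\<lambda>i. star ([rel_code (num_rel (\<lambda>m n. m = c)), set_code (range num), num c] ! i))
     (fAll 10 (fImp (Mem 10 1) (fIff (fRel 0 10 10) (Eq 10 2))))"
    by (rule transfer) (auto simp add: related_num_rel)
  then show ?thesis
    using assms by (simp add: star_rel_iff star_N_def)
qed

text \<open>The induction removes one standard number at a time: a nonstandard \<open>h\<close>
  differs from each \<open>star (num N)\<close>, so \<open>h \<ge> N\<close> improves to
  \<open>h \<ge> Suc N\<close>.\<close>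

lemma infinite_hrel:
  assumes "h \<in> star_N - standard_N"
  shows "hrel (\<lambda>m n. m \<ge> N) h h"
proof (induction N)
  case 0
  then show ?case
    using assms hrel_True by simp
next
  case (Suc N)
  have "\<not> hrel (\<lambda>m n. m = N) h h"
    using assms hrel_const by (auto simp: standard_N_def)
  then have "hrel (\<lambda>m n. m \<noteq> N) h h"
    using assms hrel_not by auto
  with Suc show ?case
    by (rule hrel_resolve) auto
qed

abbreviation extn :: "'w \<Rightarrow> 'w set" where "extn x \<equiv> {y. smem y x}"

lemma internal_Diff_extn: "\<exists>z. extn z = extn x - extn y"
proof -
  have "sat smem (\<lambda>i. star ([] ! i))
     (fAll 10 (fAll 11 (Ex 12 (fAll 13 (fIff (Mem 13 12) (Conj (Mem 13 10) (Neg (Mem 13 11))))))))"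
    by (rule transfer) (simp add: ex_Diff)
  then show ?thesis
    by (simp add: set_eq_iff)
qed

lemma internal_section: "\<exists>z. extn z = {k. hrel Q k h}"
proof -
  have "sat smem (\<lambda>i. star ([rel_code (num_rel Q)] ! i))
     (fAll 10 (Ex 12 (fAll 13 (fIff (Mem 13 12) (fRel 0 13 10)))))"
    by (rule transfer) (simp add: ex_section related_num_rel)
  then show ?thesis
    by (simp add: set_eq_iff star_rel_iff)
qed

end

section \<open>Internal cardinality and standard parts\<close>

context elementary_extension
begin

text \<open>The set \<open>a\<close> may differ from \<open>x\<close>, since a hypernatural has the same extension as the
  empty set.\<close>

lemma card_rel_exists:
  assumes "h \<in> star_N" "\<And>y. smem y x \<Longrightarrow> hrel (\<lambda>m n. 1 \<le> m \<and> m \<le> n) y h"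
  obtains a k where "extn a = extn x" "star_rel card_rel a k" "hrel (\<lambda>m n. m \<le> n) k h"
proof -
  have *: "\<exists>a k. (\<forall>z. mem z a \<longleftrightarrow> mem z x) \<and> card_rel a k \<and> num_rel (\<lambda>m n. m \<le> n) k (num n)"
    if "\<forall>y. mem y x \<longrightarrow> num_rel (\<lambda>m n. 1 \<le> m \<and> m \<le> n) y (num n)" for x n
  proof -
    define S where "S = {m. mem (num m) x}"
    have S: "S \<subseteq> {1..n}" "\<And>z. mem z x \<longleftrightarrow> z \<in> num ` S"
      using that by (auto simp: S_def num_rel_def)
    have "finite S" "card S \<le> n"
      using S(1) finite_subset card_mono[OF _ S(1)] by auto
    then show ?thesis
      using card_rel_num_image[of S] S(2) by (metis mem_set_code_nums num_rel_num)
  qed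
  have "sat smem (\<lambda>i. star ([rel_code (num_rel (\<lambda>m n. 1 \<le> m \<and> m \<le> n)), set_code (range num),
        rel_code card_rel, rel_code (num_rel (\<lambda>m n. m \<le> n))] ! i))
     (fAll 10 (fAll 11 (fImp (Conj (Mem 11 1) (fAll 12 (fImp (Mem 12 10) (fRel 0 12 11))))
        (Ex 13 (Ex 14 (Conj (fAll 15 (fIff (Mem 15 13) (Mem 15 10)))
          (Conj (fRel 2 13 14) (fRel 3 14 11))))))))"
    by (rule transfer) (use * in \<open>auto simp: related_num_rel related_card_rel\<close>)
  then have "\<exists>a k. extn a = extn x \<and> star_rel card_rel a k \<and> hrel (\<lambda>m n. m \<le> n) k h"
    using assms by (simp add: star_rel_iff star_N_def set_eq_iff)
  then show ?thesis
    using that by blast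
qed

text \<open>By transfer of \<open>card_rel_determined\<close>, all codes with the same extension
  have the same cardinality, so the description in \<open>internal_card\<close> is well
  defined.\<close>

lemma internal_card_extn:
  assumes "star_rel card_rel a k"
  shows "internal_card (extn a) = k"
proof -
  have "sat smem (\<lambda>i. star ([rel_code card_rel] ! i))
     (fAll 10 (fAll 11 (fAll 12 (fAll 13 (fImp (Conj (fRel 0 10 11) (Conj (fRel 0 12 13)
        (fAll 14 (fIff (Mem 14 10) (Mem 14 12))))) (Eq 11 13))))))"
    by (rule transfer) (auto simp: related_card_rel intro: card_rel_determined)
  then have "k' = k" if "extn a' = extn a" "star_rel card_rel a' k'" for a' k'
    using that assms by (auto simp: star_rel_iff set_eq_iff)
  then show ?thesis
    unfolding internal_card_def using assms by blast
qed

text \<open>Addition of hypernaturals is never introduced. Additivity of cardinality is stated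
  through relations to \<open>h\<close> instead: whatever \<open>P\<close> and \<open>Q\<close>
  force on the sum of two natural numbers holds of the internal cardinality of the union.\<close>

lemma card_rel_Un:
  assumes "star_rel card_rel a k" "star_rel card_rel b l" "star_rel card_rel c m"
    and "extn c = extn a \<union> extn b" "extn a \<inter> extn b = {}"
    and "hrel P k h" "hrel Q l h"
    and PQR: "\<And>k l h. P k h \<Longrightarrow> Q l h \<Longrightarrow> R (k + l) h"
  shows "hrel R m h"
proof -
  have *: "num_rel R m h" if c: "card_rel a k" "card_rel b l" "card_rel c m"
    and e: "\<forall>z. mem z c \<longleftrightarrow> mem z a \<or> mem z b" "\<forall>z. \<not> (mem z a \<and> mem z b)"
    and r: "num_rel P k h" "num_rel Q l h" for a b c k l m h
  proof -
    obtain S T U where S: "finite S" "finite T" "finite U"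
       "a = set_code (num ` S)" "b = set_code (num ` T)" "c = set_code (num ` U)"
       "k = num (card S)" "l = num (card T)" "m = num (card U)"
      using c unfolding card_rel_def by blast
    have "num ` U = num ` (S \<union> T)" "num ` (S \<inter> T) = {}"
      using e S by auto
    then have "U = S \<union> T" "S \<inter> T = {}"
      using inj_num by (simp_all add: inj_image_eq_iff)
    then have "card U = card S + card T"
      using S by (simp add: card_Un_disjoint)
    then show ?thesis
      using r S PQR by (auto simp: num_rel_def)
  qed
  have "sat smem (\<lambda>i. star ([rel_code card_rel, rel_code (num_rel P), rel_code (num_rel Q), rel_code (num_rel R)] ! i))
     (fAll 10 (fAll 11 (fAll 12 (fAll 13 (fAll 14 (fAll 15 (fAll 16 (fImp
       (Conj (fRel 0 10 13) (Conj (fRel 0 11 14) (Conj (fRel 0 12 15)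
       (Conj (fAll 20 (fIff (Mem 20 12) (fOr (Mem 20 10) (Mem 20 11))))
       (Conj (fAll 20 (Neg (Conj (Mem 20 10) (Mem 20 11))))
       (Conj (fRel 1 13 16) (fRel 2 14 16)))))))
       (fRel 3 15 16)))))))))"
    by (rule transfer) (simp add: related_num_rel related_card_rel, use * in blast)
  then have "\<forall>x xa xb xc xd xe xf. star_rel card_rel x xc \<and> star_rel card_rel xa xd \<and> star_rel card_rel xb xe \<and>
     (\<forall>z. smem z xb \<longleftrightarrow> smem z x \<or> smem z xa) \<and> (\<forall>z. smem z x \<longrightarrow> \<not> smem z xa) \<and>
     hrel P xc xf \<and> hrel Q xd xf \<longrightarrow> hrel R xe xf"
    by (simp add: star_rel_iff)
  then show ?thesis
    using assms(1-7) by blast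
qed

text \<open>An estimate valid for all sufficiently large finite \<open>n\<close> passes to the
  infinite \<open>h\<close>, because \<open>h\<close> lies above the threshold \<open>N\<close> by
  \<open>infinite_hrel\<close>.\<close>

lemma card_rel_section:
  assumes "star_rel card_rel a k" "extn a = {y. hrel Q y h}" "h \<in> star_N - standard_N"
    and QR: "\<And>n. N \<le> n \<Longrightarrow> R (card {m. Q m n}) n"
  shows "hrel R k h"
proof -
  have *: "num_rel R k h" if c: "card_rel a k"
    and e: "\<forall>z. mem z a \<longleftrightarrow> num_rel Q z h"
    and r: "num_rel (\<lambda>m n. N \<le> m) h h" for a k h
  proof -
    obtain n where n: "h = num n" "N \<le> n"
      using r by (auto simp: num_rel_def)
    obtain S where S: "finite S" "a = set_code (num ` S)" "k = num (card S)"
      using c unfolding card_rel_def by blast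
    then have "num ` S = num ` {m. Q m n}"
      using e n by (auto simp: num_rel_def)
    then have "S = {m. Q m n}"
      using inj_num by (simp add: inj_image_eq_iff)
    then show ?thesis
      using n S QR by auto
  qed
  have "sat smem (\<lambda>i. star ([rel_code card_rel, rel_code (num_rel Q), rel_code (num_rel R), rel_code (num_rel (\<lambda>m n. N \<le> m))] ! i))
     (fAll 10 (fAll 11 (fAll 12 (fImp
       (Conj (fRel 0 10 11)
       (Conj (fAll 20 (fIff (Mem 20 10) (fRel 1 20 12)))
       (fRel 3 12 12)))
       (fRel 2 11 12)))))"
    by (rule transfer) (simp add: related_num_rel related_card_rel, use * in blast)
  then have "\<forall>a k h. star_rel card_rel a k \<and> (\<forall>z. smem z a \<longleftrightarrow> hrel Q z h) \<and>
     hrel (\<lambda>m n. N \<le> m) h h \<longrightarrow> hrel R k h"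
    by (simp add: star_rel_iff)
  then show ?thesis
    using assms(1-3) infinite_hrel by blast
qed

text \<open>The property inside the description of \<open>st_quotient\<close>, kept apart so that
  existence and uniqueness can be proved for it.\<close>

definition near_quotient :: "real \<Rightarrow> 'w \<Rightarrow> 'w \<Rightarrow> bool" where
  "near_quotient r a b \<longleftrightarrow> (\<forall>\<epsilon>>0. hrel (\<lambda>m n. \<bar>real m / real n - r\<bar> < \<epsilon>) a b)"

lemma near_quotientD: "near_quotient r a b \<Longrightarrow> \<epsilon> > 0 \<Longrightarrow> hrel (\<lambda>m n. \<bar>real m / real n - r\<bar> < \<epsilon>) a b"
  by (simp add: near_quotient_def)

lemma near_quotient_unique:
  assumes "near_quotient r a b" "near_quotient s a b"
  shows "r = s"
proof (rule ccontr)
  assume "r \<noteq> s"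
  then have "\<bar>r - s\<bar> / 2 > 0"
    by simp
  moreover have "False" if "\<bar>x - r\<bar> < \<bar>r - s\<bar> / 2" "\<bar>x - s\<bar> < \<bar>r - s\<bar> / 2" for x
    using abs_triangle_ineq4[of "x - s" "x - r"] that by (simp only: diff_diff_eq2 diff_add_eq) argo
  ultimately have "hrel (\<lambda>m n. False) a b"
    using hrel_resolve[OF near_quotientD[OF assms(1)] near_quotientD[OF assms(2)]] by meson
  then show False
    using hrel_False by blast
qed

lemma st_quotient_eq: "near_quotient r a b \<Longrightarrow> st_quotient a b = r"
  unfolding st_quotient_def near_quotient_def[symmetric]
  using near_quotient_unique by blast

text \<open>The standard part exists by completeness of the reals: it is the supremum of the reals
  below the quotient. The hypothesis bounds these by 1, and 0 is one of them.\<close>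

lemma near_st_quotient:
  assumes "hrel (\<lambda>m n. m \<le> n) a b"
  shows "near_quotient (st_quotient a b) a b"
proof -
  note ab = hrel_star_N[OF assms]
  define Q where "Q = {q. hrel (\<lambda>m n. q \<le> real m / real n) a b}"
  have 0: "0 \<in> Q"
    using hrel_mono[OF assms] by (simp add: Q_def)
  have "q \<le> 1" if "q \<in> Q" for q
  proof (rule ccontr)
    assume "\<not> q \<le> 1"
    \<comment> \<open>For \<open>n = 0\<close> the quotient is 0 by convention, so the bound holds
      there too.\<close>
    moreover have "real m / real n \<le> 1" if "m \<le> n" for m n
      using that by (cases "n = 0") (simp_all add: divide_le_eq_1)
    ultimately have "False" if "m \<le> n" "q \<le> real m / real n" for m n
      using that by fastforce
    with \<open>q \<in> Q\<close> have "hrel (\<lambda>m n. False) a b"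
      unfolding Q_def mem_Collect_eq using hrel_resolve[OF assms] by blast
    then show False
      using hrel_False by blast
  qed
  then have bdd: "bdd_above Q"
    by (auto simp: bdd_above_def)
  have "near_quotient (Sup Q) a b"
    unfolding near_quotient_def
  proof (intro allI impI)
    fix \<epsilon> :: real assume "\<epsilon> > 0"
    then obtain q where q: "q \<in> Q" "Sup Q - \<epsilon> < q"
      using less_cSup_iff[OF _ bdd, of "Sup Q - \<epsilon>"] 0 by auto
    \<comment> \<open>A real beyond the supremum is outside \<open>Q\<close>, and
      \<open>hrel_not\<close> turns this into an upper bound for the quotient.\<close>
    have "Sup Q + \<epsilon> / 2 \<notin> Q"
      using cSup_upper[OF _ bdd, of "Sup Q + \<epsilon> / 2"] \<open>\<epsilon> > 0\<close> by auto
    then have "hrel (\<lambda>m n. \<not> Sup Q + \<epsilon> / 2 \<le> real m / real n) a b"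
      using hrel_not ab by (simp add: Q_def)
    moreover have "hrel (\<lambda>m n. q \<le> real m / real n) a b"
      using q by (simp add: Q_def)
    ultimately show "hrel (\<lambda>m n. \<bar>real m / real n - Sup Q\<bar> < \<epsilon>) a b"
      by (rule hrel_resolve) (use q \<open>\<epsilon> > 0\<close> in linarith)
  qed
  then show ?thesis
    using st_quotient_eq by simp
qed

lemma near_quotient_nonneg:
  assumes "near_quotient r a b"
  shows "0 \<le> r"
proof (rule ccontr)
  assume "\<not> 0 \<le> r"
  then have "hrel (\<lambda>m n. \<bar>real m / real n - r\<bar> < - r) a b"
    using near_quotientD[OF assms, of "- r"] by simp
  then have "hrel (\<lambda>m n. False) a b"
  proof (rule hrel_mono)
    fix m n :: nat assume "\<bar>real m / real n - r\<bar> < - r"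
    moreover have "0 \<le> real m / real n"
      by simp
    ultimately show False
      by linarith
  qed
  then show False
    using hrel_False by blast
qed

end

section \<open>The finitely additive measure on internal sets\<close>

locale hyperfinite_space = elementary_extension +
  fixes H :: 'b
  assumes H: "H \<in> star_N - standard_N"
begin

abbreviation Om :: "'b set" where "Om \<equiv> hyperfinite H"

text \<open>The part in \<open>\<Omega>\<close> of the extension of a set of natural numbers.\<close>

definition trace :: "(nat \<Rightarrow> bool) \<Rightarrow> 'b set" where
  "trace P = {k. hrel (\<lambda>m n. 1 \<le> m \<and> m \<le> n \<and> P m) k H}"

definition prob :: "'b set \<Rightarrow> real" where
  "prob A = st_quotient (internal_card A) H"

lemma Om_star_N: "k \<in> Om \<Longrightarrow> k \<in> star_N"
  using hrel_star_N by (auto simp: hyperfinite_def)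

text \<open>The rank condition in \<open>internal\<close> is automatic here: an element whose
  members are all hypernaturals lies in level 1.\<close>

lemma star_Pow_iff: "A \<in> star_Pow Om \<longleftrightarrow> A \<subseteq> Om \<and> (\<exists>x. A = extn x)"
proof -
  have "x \<in> star_V" if "extn x \<subseteq> Om" for x
    unfolding star_V_def using that Om_star_N by (intro UN_I[of 1]) auto
  then show ?thesis
    unfolding star_Pow_def internal_def by blast
qed

lemma trace_star_Pow: "trace P \<in> star_Pow Om"
proof -
  have "trace P \<subseteq> Om"
    unfolding trace_def hyperfinite_def by (auto elim: hrel_mono)
  then show ?thesis
    using internal_section[of "\<lambda>m n. 1 \<le> m \<and> m \<le> n \<and> P m" H] by (auto simp: star_Pow_iff trace_def)
qed

lemma trace_True: "trace (\<lambda>m. True) = Om"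
  by (simp add: trace_def hyperfinite_def)

lemma trace_mono: "k \<in> trace P \<Longrightarrow> (\<And>m. P m \<Longrightarrow> Q m) \<Longrightarrow> k \<in> trace Q"
  by (auto simp: trace_def elim: hrel_mono)

text \<open>Together with \<open>trace_not\<close> and \<open>trace_True\<close> this makes
  \<open>trace\<close> a homomorphism of Boolean algebras into the internal subsets of
  \<Omega>.\<close>

lemma trace_conj: "trace (\<lambda>m. P m \<and> Q m) = trace P \<inter> trace Q"
proof -
  have "k \<in> trace (\<lambda>m. P m \<and> Q m)" if "k \<in> trace P" "k \<in> trace Q" for k
    using that unfolding trace_def mem_Collect_eq by (rule hrel_resolve) auto
  then show ?thesis
    by (auto intro: trace_mono)
qed

lemma trace_not: "trace (\<lambda>m. \<not> P m) = Om - trace P"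
proof -
  have "k \<in> trace (\<lambda>m. \<not> P m) \<longleftrightarrow> k \<notin> trace P" if k: "k \<in> Om" for k
  proof -
    have "\<not> (k \<in> trace P \<and> k \<in> trace (\<lambda>m. \<not> P m))"
      using hrel_False[of k H] trace_conj[of P "\<lambda>m. \<not> P m"] by (auto simp: trace_def)
    moreover have "k \<in> trace (\<lambda>m. \<not> P m)" if "k \<notin> trace P"
    proof -
      have 1: "hrel (\<lambda>m n. \<not> (1 \<le> m \<and> m \<le> n \<and> P m)) k H"
        using that hrel_not[OF Om_star_N[OF k], of H] H unfolding trace_def by blast
      have 2: "hrel (\<lambda>m n. 1 \<le> m \<and> m \<le> n) k H"
        using k by (simp add: hyperfinite_def)
      show ?thesis
        unfolding trace_def mem_Collect_eq by (rule hrel_resolve[OF 1 2]) auto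
    qed
    ultimately show ?thesis
      by blast
  qed
  moreover have "trace (\<lambda>m. \<not> P m) \<subseteq> Om"
    using trace_star_Pow star_Pow_iff by blast
  ultimately show ?thesis
    by blast
qed

text \<open>Difference is the only operation obtained by transfer; unions follow by taking
  complements.\<close>

lemma algebra_star_Pow: "algebra Om (star_Pow Om)"
proof -
  have Om: "Om \<in> star_Pow Om"
    using trace_star_Pow[of "\<lambda>m. True"] trace_True by simp
  have Diff: "A - B \<in> star_Pow Om" if AB: "A \<in> star_Pow Om" "B \<in> star_Pow Om" for A B
  proof -
    obtain x y where xy: "A = extn x" "B = extn y" "A \<subseteq> Om"
      using AB unfolding star_Pow_iff by blast
    obtain z where "extn z = extn x - extn y"
      using internal_Diff_extn by blast
    with xy have "A - B = extn z" "A - B \<subseteq> Om"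
      by auto
    then show ?thesis
      unfolding star_Pow_iff by blast
  qed
  have "A \<union> B \<in> star_Pow Om" if "A \<in> star_Pow Om" "B \<in> star_Pow Om" for A B
  proof -
    have "A \<union> B = Om - ((Om - A) - B)"
      using that by (auto simp: star_Pow_iff)
    then show ?thesis
      using that Om Diff by metis
  qed
  moreover have "star_Pow Om \<subseteq> Pow Om"
    using star_Pow_iff by blast
  ultimately show ?thesis
    unfolding algebra_iff_Un using Om Diff[OF Om] Diff[OF Om Om] by simp
qed

lemma star_Pow_card:
  assumes "A \<in> star_Pow Om"
  obtains a k where "A = extn a" "star_rel card_rel a k" "near_quotient (prob A) k H"
proof -
  obtain x where x: "A = extn x" "A \<subseteq> Om"
    using assms by (auto simp: star_Pow_iff)
  have "hrel (\<lambda>m n. 1 \<le> m \<and> m \<le> n) y H" if "smem y x" for y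
    using that x by (auto simp: hyperfinite_def)
  with H obtain a k where "extn a = extn x" "star_rel card_rel a k" "hrel (\<lambda>m n. m \<le> n) k H"
    using card_rel_exists[of H x] by blast
  then show ?thesis
    using that[of a k] x near_st_quotient internal_card_extn by (metis prob_def)
qed

lemma prob_nonneg: "A \<in> star_Pow Om \<Longrightarrow> 0 \<le> prob A"
  using near_quotient_nonneg star_Pow_card by metis

lemma prob_Un:
  assumes "A \<in> star_Pow Om" "B \<in> star_Pow Om" "A \<inter> B = {}"
  shows "prob (A \<union> B) = prob A + prob B"
proof -
  have AB: "A \<union> B \<in> star_Pow Om"
    using assms algebra_star_Pow by (simp add: algebra_iff_Un)
  obtain a k where a: "A = extn a" "star_rel card_rel a k" "near_quotient (prob A) k H"
    using star_Pow_card[OF assms(1)] by blast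
  obtain b l where b: "B = extn b" "star_rel card_rel b l" "near_quotient (prob B) l H"
    using star_Pow_card[OF assms(2)] by blast
  obtain c m where c: "A \<union> B = extn c" "star_rel card_rel c m" "near_quotient (prob (A \<union> B)) m H"
    using star_Pow_card[OF AB] by blast
  have "near_quotient (prob A + prob B) m H"
    unfolding near_quotient_def
  proof (intro allI impI)
    fix \<epsilon> :: real assume "\<epsilon> > 0"
    then have e: "\<epsilon> / 2 > 0"
      by simp
    have 1: "extn c = extn a \<union> extn b" "extn a \<inter> extn b = {}"
      using a(1) b(1) c(1) assms(3) by simp_all
    have "\<bar>real (k + l) / real h - (prob A + prob B)\<bar> < \<epsilon>"
      if "\<bar>real k / real h - prob A\<bar> < \<epsilon> / 2" "\<bar>real l / real h - prob B\<bar> < \<epsilon> / 2" for k l h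
    proof -
      have "real (k + l) / real h = real k / real h + real l / real h"
        by (simp add: add_divide_distrib)
      with that show ?thesis
        by linarith
    qed
    then show "hrel (\<lambda>m n. \<bar>real m / real n - (prob A + prob B)\<bar> < \<epsilon>) m H"
      by (rule card_rel_Un[OF a(2) b(2) c(2) 1 near_quotientD[OF a(3) e] near_quotientD[OF b(3) e]])
  qed
  then show ?thesis
    using near_quotient_unique c(3) by blast
qed

text \<open>Reduces internal probabilities to counting: a limiting density over the intervals up to
  \<open>n\<close> is the value at the infinite \<open>H\<close>.\<close>

lemma prob_trace:
  assumes "(\<lambda>n. real (card {m. 1 \<le> m \<and> m \<le> n \<and> P m}) / real n) \<longlonglongrightarrow> d"
  shows "prob (trace P) = d"
proof -
  obtain a k where a: "trace P = extn a" "star_rel card_rel a k" "near_quotient (prob (trace P)) k H"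
    using star_Pow_card[OF trace_star_Pow] by blast
  have "near_quotient d k H"
    unfolding near_quotient_def
  proof (intro allI impI)
    fix \<epsilon> :: real assume "\<epsilon> > 0"
    with assms obtain N where "\<And>n. n \<ge> N \<Longrightarrow> \<bar>real (card {m. 1 \<le> m \<and> m \<le> n \<and> P m}) / real n - d\<bar> < \<epsilon>"
      unfolding LIMSEQ_def dist_real_def by blast
    then show "hrel (\<lambda>m n. \<bar>real m / real n - d\<bar> < \<epsilon>) k H"
      using card_rel_section[OF a(2), of "\<lambda>m n. 1 \<le> m \<and> m \<le> n \<and> P m" H N] a(1) H by (simp add: trace_def)
  qed
  then show ?thesis
    using near_quotient_unique a(3) by blast
qed

end

section \<open>Approximation by countable intersections of an algebra\<close>

text \<open>By uniqueness of the extension, the measure agrees with the Caratheodory outer measure.\<close>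

lemma (in algebra) outer_approximation:
  assumes N: "finite_measure N" "space N = \<Omega>" "sets N = sigma_sets \<Omega> M"
    and A: "A \<in> sets N" and e: "0 < (e :: real)"
  shows "\<exists>B. range B \<subseteq> M \<and> A \<subseteq> (\<Union>i :: nat. B i) \<and> measure N (\<Union>i. B i) \<le> measure N A + e"
proof -
  interpret N: finite_measure N by fact
  let ?f = "emeasure N" and ?O = "outer_measure M (emeasure N)"
  have M: "M \<subseteq> sets N"
    using N(3) by auto
  have pos: "positive M ?f"
    by (simp add: positive_def)
  have ca: "countably_additive M ?f"
    unfolding countably_additive_def using M suminf_emeasure by blast
  have inc: "increasing M ?f"
    unfolding increasing_def using M emeasure_mono by blast
  \<comment> \<open>The Caratheodory measurable sets form a sigma-algebra containing the algebra, so
    the outer measure is a measure on the generated sigma-algebra.\<close>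
  define ls where "ls = lambda_system \<Omega> (Pow \<Omega>) ?O"
  have ls: "measure_space \<Omega> ls ?O"
    unfolding ls_def
    by (rule sigma_algebra.caratheodory_lemma[OF sigma_algebra_Pow outer_measure_space_outer_measure[OF pos inc]])
  have "M \<subseteq> ls"
    unfolding ls_def using algebra_subset_lambda_system pos inc ca countably_additive_additive by blast
  with ls have "sigma_sets \<Omega> M \<subseteq> ls"
    by (intro sigma_algebra.sigma_sets_subset) (auto simp: measure_space_def)
  with ls have *: "measure_space \<Omega> (sigma_sets \<Omega> M) ?O"
    by (rule measure_down[OF _ sigma_algebra_sigma_sets[OF space_closed]])
  let ?N' = "measure_of \<Omega> M ?O"
  have O: "emeasure ?N' X = ?O X" if "X \<in> sigma_sets \<Omega> M" for X
    by (rule emeasure_measure_of[OF refl]) (use * that space_closed in \<open>auto simp: measure_space_def\<close>)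
  \<comment> \<open>Both finite measures agree on the algebra, which is stable under intersections
    and generates.\<close>
  have "N = ?N'"
  proof (rule measure_eqI_generator_eq[where E = M and A = "\<lambda>_. \<Omega>"])
    show "Int_stable M"
      by (simp add: Int_stable_def Int)
    show "emeasure N X = emeasure ?N' X" if "X \<in> M" for X
      using that O outer_measure_agrees[OF pos ca] by auto
  qed (use N space_closed in \<open>auto simp: N.emeasure_finite\<close>)
  then have "?O A = ?f A"
    using O A N(3) by simp
  also have "\<dots> < ennreal (measure N A + e)"
    using e by (simp add: N.emeasure_eq_measure ennreal_lessI add_nonneg_pos)
  finally obtain B where B: "range B \<subseteq> M" "A \<subseteq> (\<Union>i. B i)" "(\<Sum>i. ?f (B i)) < ennreal (measure N A + e)"
    using outer_measure_close by meson
  have "ennreal (measure N (\<Union>i. B i)) \<le> (\<Sum>i. ?f (B i))"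
    using emeasure_subadditive_countably[of B N] B(1) M by (auto simp: N.emeasure_eq_measure)
  with B(3) have "ennreal (measure N (\<Union>i. B i)) \<le> ennreal (measure N A + e)"
    by order
  then have "measure N (\<Union>i. B i) \<le> measure N A + e"
    using e by (subst (asm) ennreal_le_iff) auto
  with B show ?thesis
    by blast
qed

text \<open>A cover of the complement of \<open>A\<close> by sets of the algebra is complemented;
  the complements stay in the algebra.\<close>

lemma (in algebra) inner_approximation:
  assumes N: "finite_measure N" "space N = \<Omega>" "sets N = sigma_sets \<Omega> M"
    and A: "A \<in> sets N" and e: "0 < (e :: real)"
  shows "\<exists>B. range B \<subseteq> M \<and> (\<Inter>i :: nat. B i) \<subseteq> A \<and> measure N A \<le> measure N (\<Inter>i. B i) + e"
proof -
  interpret N: finite_measure N by fact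
  obtain B where B: "range B \<subseteq> M" "\<Omega> - A \<subseteq> (\<Union>i :: nat. B i)"
      "measure N (\<Union>i. B i) \<le> measure N (\<Omega> - A) + e"
    using outer_approximation[OF N _ e, of "\<Omega> - A"] A N(2) sets.compl_sets by metis
  have BN: "B i \<in> sets N" for i
    using B(1) N(3) by auto
  have eq: "(\<Inter>i. \<Omega> - B i) = \<Omega> - (\<Union>i. B i)"
    by blast
  have "measure N (\<Inter>i. \<Omega> - B i) = measure N \<Omega> - measure N (\<Union>i. B i)"
    unfolding eq using N.finite_measure_compl[of "\<Union>i. B i"] BN N(2) by auto
  moreover have "measure N (\<Omega> - A) = measure N \<Omega> - measure N A"
    unfolding N(2)[symmetric] by (rule N.finite_measure_compl) (use A in auto)
  moreover have "(\<Inter>i. \<Omega> - B i) \<subseteq> A" "range (\<lambda>i. \<Omega> - B i) \<subseteq> M"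
    using B by auto
  ultimately show ?thesis
    using B(3) by (intro exI[of _ "\<lambda>i. \<Omega> - B i"]) auto
qed

section \<open>Cantor space and binary digits\<close>

lemma branches_iff: "f \<in> branches T \<longleftrightarrow> (\<forall>n. map f [0..<n] \<in> T)"
  by (simp add: branches_def)

text \<open>A sequence that is no branch leaves \<open>T\<close> at some finite stage, and the
  cylinder of that initial segment is open.\<close>

lemma closed_branches: "closed (branches T)"
proof -
  have coord: "open {f :: nat \<Rightarrow> bool. f i = b}" for i b
    using open_vimage[of "{b}" "\<lambda>f :: nat \<Rightarrow> bool. f i"] by (simp add: vimage_def Topological_Spaces.open_discrete)
  have "open {f :: nat \<Rightarrow> bool. map f [0..<n] = s}" for n s
  proof (cases "length s = n")
    case True
    then have "{f. map f [0..<n] = s} = (\<Inter>i\<in>{..<n}. {f. f i = s ! i})"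
      by (auto simp: list_eq_iff_nth_eq)
    then show ?thesis
      using coord by auto
  next
    case False
    then have "{f. map f [0..<n] = s} = {}"
      by auto
    then show ?thesis
      by simp
  qed
  moreover have "- branches T = (\<Union>n. \<Union>s\<in>-T. {f. map f [0..<n] = s})"
    by (auto simp: branches_iff)
  ultimately show ?thesis
    unfolding closed_def by auto
qed

lemma compact_Cantor: "compact (UNIV :: (nat \<Rightarrow> bool) set)"
proof -
  have "compact_space (product_topology (\<lambda>_ :: nat. euclidean :: bool topology) UNIV)"
    unfolding compact_space_product_topology by (simp add: compact_space_def finite_imp_compact)
  then show ?thesis
    by (simp add: euclidean_product_topology compact_space_def compactin_euclidean_iff)
qed

lemma common_branch:
  assumes "\<And>F. finite F \<Longrightarrow> F \<subseteq> \<T> \<Longrightarrow> \<exists>f. \<forall>T\<in>F. f \<in> branches T"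
  shows "\<exists>f. \<forall>T\<in>\<T>. f \<in> branches T"
proof -
  have "UNIV \<inter> \<Inter>(branches ` \<T>) \<noteq> {}"
  proof (rule compact_imp_fip[OF compact_Cantor])
    fix F assume "finite F" "F \<subseteq> branches ` \<T>"
    then obtain F' where "F' \<subseteq> \<T>" "finite F'" "F = branches ` F'"
      using finite_subset_image by meson
    then show "UNIV \<inter> \<Inter>F \<noteq> {}"
      using assms by fastforce
  qed (auto simp: closed_branches)
  then show ?thesis
    by blast
qed

section \<open>The coin-tossing measure and the density of binary words\<close>

interpretation coin: product_prob_space "\<lambda>_ :: nat. measure_pmf (bernoulli_pmf (1/2))" UNIV
  by unfold_locales

lemma prob_space_coin: "prob_space coin_measure"
  unfolding coin_measure_def by (rule coin.P.prob_space_axioms)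

lemma measure_coin_cylinder:
  "{f. map f [0..<k] \<in> W} \<in> sets coin_measure"
  "measure coin_measure {f. map f [0..<k] \<in> W} = real (card {s\<in>W. length s = k}) / 2 ^ k"
proof -
  interpret prob_space coin_measure by (rule prob_space_coin)
  have cyl: "{f. map f [0..<k] = s} =
      prod_emb UNIV (\<lambda>_. measure_pmf (bernoulli_pmf (1/2))) {..<k} (Pi\<^sub>E {..<k} (\<lambda>i. {s ! i}))"
    if "length s = k" for s
    using that by (auto simp: prod_emb_def list_eq_iff_nth_eq PiE_def Pi_def)
  have 1: "{f. map f [0..<k] = s} \<in> sets coin_measure" if "length s = k" for s
    unfolding cyl[OF that] coin_measure_def by (rule sets_PiM_I) auto
  have 2: "measure coin_measure {f. map f [0..<k] = s} = 1 / 2 ^ k" if "length s = k" for s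
    unfolding cyl[OF that] coin_measure_def
    by (subst coin.measure_PiM_emb) (auto simp: measure_pmf_single power_one_over)
  have fin: "finite {s\<in>W. length s = k}"
    using finite_lists_length_eq[of "UNIV :: bool set" k] by (auto elim: rev_finite_subset)
  have U: "{f. map f [0..<k] \<in> W} = (\<Union>s\<in>{s\<in>W. length s = k}. {f. map f [0..<k] = s})"
    by auto
  show "{f. map f [0..<k] \<in> W} \<in> sets coin_measure"
    unfolding U by (rule sets.finite_UN[OF fin]) (use 1 in auto)
  have "measure coin_measure {f. map f [0..<k] \<in> W} =
      (\<Sum>s\<in>{s\<in>W. length s = k}. measure coin_measure {f. map f [0..<k] = s})"
    unfolding U by (rule finite_measure_finite_Union[OF fin]) (use 1 in \<open>auto simp: disjoint_family_on_def\<close>)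
  then show "measure coin_measure {f. map f [0..<k] \<in> W} = real (card {s\<in>W. length s = k}) / 2 ^ k"
    by (simp add: 2)
qed

text \<open>The count up to \<open>n\<close> differs from \<open>n / p\<close> by at most 2, an
  error that vanishes after division by \<open>n\<close>.\<close>

lemma residue_class_density:
  assumes "r < p"
  shows "(\<lambda>n. real (card {m. 1 \<le> m \<and> m \<le> n \<and> m mod p = r}) / real n) \<longlonglongrightarrow> 1 / real p"
proof -
  define c where "c n = card {m. 1 \<le> m \<and> m \<le> n \<and> m mod p = r}" for n
  have inj: "inj_on (\<lambda>q. p * q + r) X" for X
    using assms by (auto simp: inj_on_def)
  have bound: "\<bar>real (c n) - real n / real p\<bar> \<le> 2" for n
  proof -
    \<comment> \<open>The value \<open>q = 0\<close> is left out because it gives 0 when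
      \<open>r = 0\<close>, and \<open>q = n div p\<close> because \<open>p * q + r\<close> may
      exceed \<open>n\<close>.\<close>
    have "(\<lambda>q. p * q + r) ` {1..<n div p} \<subseteq> {m. 1 \<le> m \<and> m \<le> n \<and> m mod p = r}"
    proof clarsimp
      fix q assume q: "Suc 0 \<le> q" "q < n div p"
      have "p * q + r \<le> p * Suc q"
        using assms by simp
      also have "\<dots> \<le> p * (n div p)"
        using q by (intro mult_le_mono2) simp
      also have "\<dots> \<le> n"
        by simp
      finally show "Suc 0 \<le> p * q + r \<and> p * q + r \<le> n \<and> r mod p = r"
        using q assms by (auto simp: Suc_le_eq)
    qed
    then have "card ((\<lambda>q. p * q + r) ` {1..<n div p}) \<le> c n"
      unfolding c_def by (intro card_mono) auto
    then have lower: "n div p \<le> c n + 1"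
      by (simp add: card_image[OF inj])
    have "{m. 1 \<le> m \<and> m \<le> n \<and> m mod p = r} \<subseteq> (\<lambda>q. p * q + r) ` {..n div p}"
    proof
      fix m assume "m \<in> {m. 1 \<le> m \<and> m \<le> n \<and> m mod p = r}"
      then have "m = p * (m div p) + r" "m div p \<le> n div p"
        by (auto simp: div_le_mono)
      then show "m \<in> (\<lambda>q. p * q + r) ` {..n div p}"
        by blast
    qed
    then have "c n \<le> card ((\<lambda>q. p * q + r) ` {..n div p})"
      unfolding c_def by (intro card_mono) auto
    then have upper: "c n \<le> n div p + 1"
      by (simp add: card_image[OF inj])
    have "real n / real p - 1 \<le> real (n div p)" "real (n div p) \<le> real n / real p"
      using floor_divide_of_nat_eq[of n p, where ?'a = real] by linarith+
    with lower upper show ?thesis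
      by linarith
  qed
  have "norm (real (c n) / real n - 1 / real p) \<le> 2 / real n" if "0 < n" for n
  proof -
    have "real (c n) / real n - 1 / real p = (real (c n) - real n / real p) / real n"
      using that by (simp add: field_simps)
    then show ?thesis
      using bound[of n] by (simp add: abs_divide divide_right_mono)
  qed
  then have "\<forall>\<^sub>F n in sequentially. norm (real (c n) / real n - 1 / real p) \<le> 2 / real n"
    using eventually_gt_at_top[of 0] by (rule eventually_mono[rotated])
  moreover have "(\<lambda>n. 2 / real n) \<longlonglongrightarrow> 0"
    by real_asymp
  ultimately have "(\<lambda>n. real (c n) / real n - 1 / real p) \<longlonglongrightarrow> 0"
    by (rule Lim_null_comparison)
  then show ?thesis
    unfolding c_def by (rule LIM_zero_cancel)
qed

text \<open>\<open>horner_sum of_bool 2 s\<close> is the number with binary digits \<open>s\<close>,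
  least significant first; a prescribed block of low digits is thus a residue class modulo
  \<open>2 ^ k\<close>.\<close>

lemma digits_eq_iff:
  assumes "length s = k"
  shows "map (bit m) [0..<k] = s \<longleftrightarrow> (m :: nat) mod 2 ^ k = horner_sum of_bool 2 s"
proof
  assume "map (bit m) [0..<k] = s"
  then show "m mod 2 ^ k = horner_sum of_bool 2 s"
    using horner_sum_bit_eq_take_bit[of m k] by (simp add: take_bit_eq_mod)
next
  assume m: "m mod 2 ^ k = horner_sum of_bool 2 s"
  have "bit m i = s ! i" if "i < k" for i
    using that assms m bit_take_bit_iff[of k m i] bit_horner_sum_bit_iff[of s i, where ?'a = nat]
    by (simp add: take_bit_eq_mod)
  then show "map (bit m) [0..<k] = s"
    using assms by (simp add: list_eq_iff_nth_eq)
qed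

text \<open>Each word of length \<open>k\<close> contributes a residue class of density
  \<open>1 / 2 ^ k\<close>, which is also the coin measure of its cylinder; the words in
  \<open>W\<close> are summed.\<close>

lemma digits_density:
  "(\<lambda>n. real (card {m. 1 \<le> m \<and> m \<le> n \<and> map (bit m) [0..<k] \<in> W}) / real n)
     \<longlonglongrightarrow> measure coin_measure {f. map f [0..<k] \<in> W}"
proof -
  let ?W = "{s\<in>W. length s = k}"
  let ?C = "\<lambda>n s. {m. 1 \<le> m \<and> m \<le> n \<and> map (bit m) [0..<k] = s}"
  have fin: "finite ?W"
    using finite_lists_length_eq[of "UNIV :: bool set" k] by (auto elim: rev_finite_subset)
  have "(\<lambda>n. real (card (?C n s)) / real n) \<longlonglongrightarrow> 1 / 2 ^ k" if s: "s \<in> ?W" for s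
  proof -
    have "(horner_sum of_bool 2 s :: nat) < 2 ^ k"
      using s horner_sum_bound[of s, where ?'a = nat] by simp
    from residue_class_density[OF this] show ?thesis
      using s by (simp add: digits_eq_iff)
  qed
  then have "(\<lambda>n. \<Sum>s\<in>?W. real (card (?C n s)) / real n) \<longlonglongrightarrow> (\<Sum>s\<in>?W. 1 / 2 ^ k)"
    by (rule tendsto_sum)
  moreover have "(\<Sum>s\<in>?W. real (card (?C n s)) / real n) =
      real (card {m. 1 \<le> m \<and> m \<le> n \<and> map (bit m) [0..<k] \<in> W}) / real n" for n
  proof -
    have "{m. 1 \<le> m \<and> m \<le> n \<and> map (bit m) [0..<k] \<in> W} = (\<Union>s\<in>?W. ?C n s)"
      by auto
    then have "card {m. 1 \<le> m \<and> m \<le> n \<and> map (bit m) [0..<k] \<in> W} = (\<Sum>s\<in>?W. card (?C n s))"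
      by (simp add: card_UN_disjoint[OF fin] disjoint_iff)
    then show ?thesis
      by (simp add: sum_divide_distrib)
  qed
  ultimately show ?thesis
    by (simp add: measure_coin_cylinder)
qed

section \<open>Compactness of the Loeb space\<close>

lemma countable_ordLeq_natLeq:
  assumes "countable X"
  shows "|X| \<le>o natLeq"
proof -
  obtain f :: "_ \<Rightarrow> nat" where "inj_on f X"
    using assms by (auto simp: countable_def)
  then have "|X| \<le>o |UNIV :: nat set|"
    by (rule card_of_ordLeqI) simp
  then show ?thesis
    using card_of_nat ordLeq_ordIso_trans by blast
qed

text \<open>For finite \<open>X\<close> the product is countable and \<kappa> is not; an infinite
  \<open>X\<close> absorbs the countable factor.\<close>

lemma card_of_Times_nat_ordLess:
  assumes \<kappa>: "Card_order \<kappa>" "natLeq <o \<kappa>" and X: "|X| <o \<kappa>"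
  shows "|X \<times> (UNIV :: nat set)| <o \<kappa>"
proof (cases "finite X")
  case True
  then have "|X \<times> (UNIV :: nat set)| \<le>o natLeq"
    by (intro countable_ordLeq_natLeq countable_SIGMA) (auto intro: countable_finite)
  then show ?thesis
    using \<kappa>(2) ordLeq_ordLess_trans by blast
next
  case False
  then have "|UNIV :: nat set| \<le>o |X|"
    using infinite_iff_card_of_nat by blast
  then have "|X \<times> (UNIV :: nat set)| =o |X|"
    using False card_of_Times_infinite by blast
  then show ?thesis
    using X ordIso_ordLess_trans by blast
qed

section \<open>The Loeb measure and the digit map to Cantor space\<close>

locale saturated_hyperfinite_space = hyperfinite_space +
  fixes \<kappa> :: "'k rel"
  assumes \<kappa>: "Card_order \<kappa>" "natLeq <o \<kappa>" and saturated: "saturated \<kappa>"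
begin

lemma saturation:
  assumes "D \<subseteq> star_Pow Om" "|D| <o \<kappa>" "fip D"
  shows "\<Inter>D \<noteq> {}"
  using saturated assms unfolding saturated_def star_Pow_def by blast

text \<open>A decreasing sequence of nonempty sets has the finite intersection property, and its
  range is countable, hence smaller than \<kappa>.\<close>

lemma countable_saturation:
  assumes "range A \<subseteq> star_Pow Om" "decseq A" "(\<Inter>i :: nat. A i) = {}"
  shows "\<exists>i. A i = {}"
proof (rule ccontr)
  assume ne: "\<not> (\<exists>i. A i = {})"
  have "fip (range A)"
    unfolding fip_def
  proof (intro allI impI)
    fix F assume "F \<subseteq> range A \<and> finite F \<and> F \<noteq> {}"
    then obtain I where I: "finite I" "F = A ` I"
      using finite_subset_image by metis
    have "A (Max I) \<subseteq> A i" if "i \<in> I" for i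
      using that I(1) assms(2) by (simp add: decseq_def)
    then show "\<Inter>F \<noteq> {}"
      using ne I(2) by blast
  qed
  moreover have "|range A| <o \<kappa>"
    using \<kappa>(2) countable_ordLeq_natLeq[of "range A"] ordLeq_ordLess_trans by auto
  ultimately show False
    using saturation assms(1,3) by blast
qed

sublocale int: algebra Om "star_Pow Om"
  by (rule algebra_star_Pow)

lemma prob_empty: "prob {} = 0"
  using prob_Un[of "{}" "{}"] by simp

text \<open>The Loeb measure before completion. That the prescribed values do extend to a measure is
  shown in \<open>emeasure_loeb0\<close>.\<close>

definition loeb0 :: "'b measure" where
  "loeb0 = extend_measure Om (star_Pow Om) (\<lambda>A. A) (\<lambda>A. ennreal (prob A))"

lemma loeb_eq: "loeb H = completion loeb0"
  by (simp add: loeb_def loeb0_def prob_def)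

lemma space_loeb0 [simp]: "space loeb0 = Om"
  and sets_loeb0: "sets loeb0 = sigma_sets Om (star_Pow Om)"
  using int.space_closed by (simp_all add: loeb0_def space_extend_measure sets_extend_measure)

lemma star_Pow_sets: "A \<in> star_Pow Om \<Longrightarrow> A \<in> sets loeb0"
  by (simp add: sets_loeb0)

text \<open>The continuity at the empty set required by Caratheodory's theorem is immediate: by
  saturation, a decreasing sequence of internal sets with empty intersection is eventually
  empty.\<close>

lemma emeasure_loeb0:
  assumes "A \<in> star_Pow Om"
  shows "emeasure loeb0 A = ennreal (prob A)"
proof -
  have "\<exists>\<mu>. (\<forall>s \<in> star_Pow Om. \<mu> s = ennreal (prob s)) \<and>
      measure_space Om (sigma_sets Om (star_Pow Om)) \<mu>"
  proof (rule int.caratheodory_empty_continuous)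
    show "positive (star_Pow Om) (\<lambda>s. ennreal (prob s))"
      by (simp add: positive_def prob_empty)
    show "additive (star_Pow Om) (\<lambda>s. ennreal (prob s))"
      by (simp add: additive_def prob_Un prob_nonneg)
    fix A :: "nat \<Rightarrow> 'b set"
    assume A: "range A \<subseteq> star_Pow Om" "decseq A" "(\<Inter>i. A i) = {}"
    then obtain i where "A i = {}"
      using countable_saturation by blast
    then have "A j = {}" if "j \<ge> i" for j
      using that A(2) unfolding decseq_def by blast
    then show "(\<lambda>i. ennreal (prob (A i))) \<longlonglongrightarrow> 0"
      by (intro tendsto_eventually eventually_sequentiallyI[of i]) (simp add: prob_empty)
  qed simp
  then obtain \<mu> where \<mu>: "\<And>s. s \<in> star_Pow Om \<Longrightarrow> \<mu> s = ennreal (prob s)"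
      "measure_space Om (sigma_sets Om (star_Pow Om)) \<mu>"
    by blast
  show ?thesis
    by (rule emeasure_extend_measure[where \<mu>' = \<mu> and G = "\<lambda>A. A", OF loeb0_def])
       (use \<mu> assms int.space_closed in \<open>auto simp: sets_loeb0 measure_space_def\<close>)
qed

sublocale loeb0: finite_measure loeb0
  by standard (simp add: emeasure_loeb0)

lemma measure_loeb0: "A \<in> star_Pow Om \<Longrightarrow> measure loeb0 A = prob A"
  by (simp add: measure_def emeasure_loeb0 prob_nonneg)

text \<open>Only the digits at standard positions are read, so the result is a point of Cantor
  space.\<close>

definition digits :: "'b \<Rightarrow> nat \<Rightarrow> bool" where
  "digits x i \<longleftrightarrow> x \<in> trace (\<lambda>m. bit m i)"

text \<open>The first \<open>k\<close> digits, for a standard \<open>k\<close>, are fixed by a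
  finite conjunction of traces, built up by induction on \<open>k\<close>.\<close>

lemma trace_digits: "trace (\<lambda>m. map (bit m) [0..<k] \<in> W) = {x\<in>Om. map (digits x) [0..<k] \<in> W}"
proof -
  have *: "x \<in> trace (\<lambda>m. map (bit m) [0..<k] = map (digits x) [0..<k])" if x: "x \<in> Om" for x
  proof (induction k)
    case 0
    then show ?case
      using x trace_True by simp
  next
    case (Suc k)
    have "x \<in> trace (\<lambda>m. bit m k = digits x k)"
      using x trace_not[of "\<lambda>m. bit m k"] by (cases "digits x k") (auto simp: digits_def)
    with Suc have "x \<in> trace (\<lambda>m. map (bit m) [0..<k] = map (digits x) [0..<k] \<and> bit m k = digits x k)"
      by (simp add: trace_conj)
    then show ?case
      by (rule trace_mono) simp
  qed
  have iff: "x \<in> trace (\<lambda>m. map (bit m) [0..<k] \<in> W) \<longleftrightarrow> map (digits x) [0..<k] \<in> W" if x: "x \<in> Om" for x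
  proof
    assume "x \<in> trace (\<lambda>m. map (bit m) [0..<k] \<in> W)"
    with * x have "x \<in> trace (\<lambda>m. map (bit m) [0..<k] = map (digits x) [0..<k] \<and> map (bit m) [0..<k] \<in> W)"
      by (simp add: trace_conj)
    then have "map (digits x) [0..<k] \<notin> W \<Longrightarrow> x \<in> trace (\<lambda>m. \<not> True)"
      by (rule trace_mono) metis
    then show "map (digits x) [0..<k] \<in> W"
      using x trace_not[of "\<lambda>m. True"] trace_True by auto
  next
    assume "map (digits x) [0..<k] \<in> W"
    with *[OF x] show "x \<in> trace (\<lambda>m. map (bit m) [0..<k] \<in> W)"
      by (elim trace_mono) metis
  qed
  have "trace (\<lambda>m. map (bit m) [0..<k] \<in> W) \<subseteq> Om"
    using trace_star_Pow star_Pow_iff by blast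
  with iff show ?thesis
    by blast
qed

lemma digits_cylinder_star_Pow: "{x\<in>Om. map (digits x) [0..<k] \<in> W} \<in> star_Pow Om"
  using trace_star_Pow trace_digits by metis

lemma measure_digits_cylinder:
  "measure loeb0 {x\<in>Om. map (digits x) [0..<k] \<in> W} = measure coin_measure {f. map f [0..<k] \<in> W}"
  using measure_loeb0[OF digits_cylinder_star_Pow] prob_trace[OF digits_density] trace_digits by metis

lemma digits_branches_sets: "{x\<in>Om. digits x \<in> branches T} \<in> sets loeb0"
proof -
  have "{x\<in>Om. digits x \<in> branches T} = (\<Inter>k. {x\<in>Om. map (digits x) [0..<k] \<in> T})"
    by (auto simp: branches_iff)
  then show ?thesis
    using digits_cylinder_star_Pow star_Pow_sets by auto
qed

text \<open>Trees are closed under initial segments, so their cylinders decrease to the branches.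
  Each cylinder has the same measure on both sides and contains all branches; continuity from above
  on the Loeb side gives the inequality.\<close>

lemma measure_digits_branches:
  assumes "tree T"
  shows "measure coin_measure (branches T) \<le> measure loeb0 {x\<in>Om. digits x \<in> branches T}"
proof -
  interpret coin: prob_space coin_measure
    by (rule prob_space_coin)
  let ?Z = "\<lambda>k. {x\<in>Om. map (digits x) [0..<k] \<in> T}"
  have Z: "{x\<in>Om. digits x \<in> branches T} = (\<Inter>k. ?Z k)"
    by (auto simp: branches_iff)
  have "prefix (map f [0..<k]) (map f [0..<Suc k])" for f :: "nat \<Rightarrow> bool" and k
    by simp
  then have "decseq ?Z"
    using assms unfolding tree_def by (intro decseq_SucI) blast
  then have "(\<lambda>k. measure loeb0 (?Z k)) \<longlonglongrightarrow> measure loeb0 (\<Inter>k. ?Z k)"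
    using digits_cylinder_star_Pow star_Pow_sets by (intro loeb0.finite_Lim_measure_decseq) auto
  moreover have "measure coin_measure (branches T) \<le> measure loeb0 (?Z k)" for k
    unfolding measure_digits_cylinder
    by (rule coin.finite_measure_mono[OF _ measure_coin_cylinder(1)]) (auto simp: branches_iff)
  ultimately show ?thesis
    unfolding Z by (intro LIMSEQ_le_const) auto
qed

end

section \<open>The compact inner-regular family\<close>

locale witnessed_space = saturated_hyperfinite_space +
  fixes lam :: "'l rel" and T :: "'l \<Rightarrow> nat \<Rightarrow> bool list set" and A :: "'l \<Rightarrow> 'b set"
  assumes witness: "witness \<kappa> lam T" and enum: "A ` Field lam = star_Pow Om"
begin

definition cell :: "'l \<Rightarrow> nat \<Rightarrow> 'b set" where
  "cell \<alpha> n = {x\<in>A \<alpha>. digits x \<in> branches (T \<alpha> n)}"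

text \<open>Countable intersections are needed for inner regularity: a measurable set is
  approximated by a countable intersection of internal sets, and each of these is then shrunk to a
  cell.\<close>

definition family :: "'b set set" where
  "family = {\<Inter>i. cell (a i) (n i) | (a :: nat \<Rightarrow> 'l) n. range a \<subseteq> Field lam}"

lemma A_star_Pow: "\<alpha> \<in> Field lam \<Longrightarrow> A \<alpha> \<in> star_Pow Om"
  using enum by blast

lemma A_Om: "\<alpha> \<in> Field lam \<Longrightarrow> A \<alpha> \<subseteq> Om"
  using A_star_Pow star_Pow_iff by blast

lemma cell_eq: "\<alpha> \<in> Field lam \<Longrightarrow> cell \<alpha> n = A \<alpha> \<inter> {x\<in>Om. digits x \<in> branches (T \<alpha> n)}"
  using A_Om by (auto simp: cell_def)

lemma cell_sets: "\<alpha> \<in> Field lam \<Longrightarrow> cell \<alpha> n \<in> sets loeb0"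
  using A_star_Pow star_Pow_sets digits_branches_sets by (auto simp: cell_eq)

lemma family_sets: "family \<subseteq> sets loeb0"
proof -
  have "(\<Inter>i. cell (a i) (n i)) \<in> sets loeb0" if "range a \<subseteq> Field lam" for a :: "nat \<Rightarrow> 'l" and n
    using that cell_sets by (intro sets.countable_INT) auto
  then show ?thesis
    by (auto simp: family_def)
qed

text \<open>The part removed lies outside the preimage of the branches, which has measure above
  \<open>n / (n + 1)\<close> in a space of total mass 1.\<close>

lemma measure_Diff_cell:
  assumes "\<alpha> \<in> Field lam"
  shows "measure loeb0 (A \<alpha> - cell \<alpha> n) \<le> 1 / real (n + 1)"
proof -
  let ?B = "{x\<in>Om. digits x \<in> branches (T \<alpha> n)}"
  have "tree (T \<alpha> n)" "measure coin_measure (branches (T \<alpha> n)) > real n / real (n + 1)"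
    using witness assms unfolding witness_def by blast+
  then have "real n / real (n + 1) < measure loeb0 ?B"
    using measure_digits_branches[of "T \<alpha> n"] by linarith
  moreover have "measure loeb0 Om = 1"
  proof -
    interpret coin: prob_space coin_measure
      by (rule prob_space_coin)
    have "space coin_measure = UNIV"
      by (simp add: coin_measure_def space_PiM PiE_def)
    then show ?thesis
      \<comment> \<open>With no digit prescribed the cylinder is all of \<Omega>, which gives its
        total mass.\<close>
      using measure_digits_cylinder[of 0 UNIV] coin.prob_space by simp
  qed
  moreover have "measure loeb0 (Om - ?B) = measure loeb0 Om - measure loeb0 ?B"
    using loeb0.finite_measure_compl[OF digits_branches_sets] by simp
  moreover have "measure loeb0 (A \<alpha> - cell \<alpha> n) \<le> measure loeb0 (Om - ?B)"
    using A_Om[OF assms] digits_branches_sets[of "T \<alpha> n"] sets.top[of loeb0]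
    by (intro loeb0.finite_measure_mono) (auto simp: cell_def simp del: sets.top)
  moreover have "1 - real n / real (n + 1) = 1 / real (n + 1)"
    by (simp add: field_simps)
  ultimately show ?thesis
    by linarith
qed

lemma compact_family: "compact_family family"
  unfolding compact_family_def
proof (intro allI impI)
  fix D assume D: "D \<subseteq> family \<and> fip D"
  \<comment> \<open>\<open>D\<close> is replaced by the cells that include one of its members. Each
    member is an intersection of such cells, so a point common to these cells lies in all of
    \<open>D\<close>.\<close>
  define J where "J = {(\<alpha>, n). \<alpha> \<in> Field lam \<and> (\<exists>K\<in>D. K \<subseteq> cell \<alpha> n)}"
  have cells: "\<exists>x. \<forall>(\<alpha>, n)\<in>F. x \<in> cell \<alpha> n" if F: "finite F" "F \<subseteq> J" for F
  proof (cases "F = {}")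
    case False
    have "\<forall>j\<in>F. \<exists>K\<in>D. K \<subseteq> cell (fst j) (snd j)"
      using F(2) by (auto simp: J_def)
    then obtain K where K: "\<And>j. j \<in> F \<Longrightarrow> K j \<in> D \<and> K j \<subseteq> cell (fst j) (snd j)"
      by metis
    have "K ` F \<subseteq> D" "finite (K ` F)" "K ` F \<noteq> {}"
      using K F(1) False by auto
    then have "\<Inter>(K ` F) \<noteq> {}"
      using D unfolding fip_def by meson
    then obtain x where "\<And>j. j \<in> F \<Longrightarrow> x \<in> K j"
      by blast
    with K have "\<And>j. j \<in> F \<Longrightarrow> x \<in> cell (fst j) (snd j)"
      by blast
    then show ?thesis
      by (intro exI[of _ x]) (simp add: case_prod_unfold)
  qed simp
  \<comment> \<open>Finitely many of the trees share the digit sequence of a common point of the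
    corresponding cells.\<close>
  have "\<exists>f. \<forall>t\<in>(\<lambda>(\<alpha>, n). T \<alpha> n) ` J. f \<in> branches t"
  proof (rule common_branch)
    fix F assume "finite F" "F \<subseteq> (\<lambda>(\<alpha>, n). T \<alpha> n) ` J"
    then obtain F' where F': "finite F'" "F' \<subseteq> J" "F = (\<lambda>(\<alpha>, n). T \<alpha> n) ` F'"
      using finite_subset_image by metis
    then obtain x where "\<forall>(\<alpha>, n)\<in>F'. x \<in> cell \<alpha> n"
      using cells by blast
    with F'(3) show "\<exists>f. \<forall>t\<in>F. f \<in> branches t"
      by (intro exI[of _ "digits x"]) (auto simp: cell_def)
  qed
  then obtain f where f: "\<And>\<alpha> n. (\<alpha>, n) \<in> J \<Longrightarrow> f \<in> branches (T \<alpha> n)"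
    by fast
  \<comment> \<open>Every first index in \<open>J\<close> belongs to \<open>X\<close>, and the
    witness makes \<open>X\<close> smaller than \<kappa>. The two countable factors added next
    account for \<open>n\<close> and for the digit length \<open>k\<close>.\<close>
  define X where "X = {\<alpha>\<in>Field lam. \<exists>n. f \<in> branches (T \<alpha> n)}"
  have "|X| <o \<kappa>"
    using witness unfolding witness_def X_def by blast
  then have X: "|(X \<times> UNIV) \<times> UNIV :: (('l \<times> nat) \<times> nat) set| <o \<kappa>"
    by (intro card_of_Times_nat_ordLess[OF \<kappa>])
  \<comment> \<open>Cells need not be internal, so saturation cannot be applied to them directly; a
    cell is the intersection over \<open>k\<close> of these internal sets.\<close>
  define E where "E = (\<lambda>((\<alpha>, n), k). A \<alpha> \<inter> {x\<in>Om. map (digits x) [0..<k] \<in> T \<alpha> n})"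
  have JX: "J \<times> UNIV \<subseteq> (X \<times> UNIV) \<times> UNIV"
    using f by (auto simp: J_def X_def)
  have "|E ` (J \<times> UNIV)| \<le>o |(X \<times> UNIV) \<times> UNIV :: (('l \<times> nat) \<times> nat) set|"
    by (rule ordLeq_transitive[OF card_of_image card_of_mono1[OF JX]])
  from this X have "|E ` (J \<times> UNIV)| <o \<kappa>"
    by (rule ordLeq_ordLess_trans)
  moreover have "E ` (J \<times> UNIV) \<subseteq> star_Pow Om"
    using A_star_Pow digits_cylinder_star_Pow by (auto simp: E_def J_def intro!: int.Int)
  moreover have "fip (E ` (J \<times> UNIV))"
    unfolding fip_def
  proof (intro allI impI)
    fix F assume "F \<subseteq> E ` (J \<times> UNIV) \<and> finite F \<and> F \<noteq> {}"
    then obtain F' where F': "finite F'" "F' \<subseteq> J \<times> UNIV" "F = E ` F'"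
      using finite_subset_image by metis
    then have "finite (fst ` F')" "fst ` F' \<subseteq> J"
      by auto
    then obtain x where "\<forall>(\<alpha>, n)\<in>fst ` F'. x \<in> cell \<alpha> n"
      using cells by blast
    then have "x \<in> E j" if "j \<in> F'" for j
      using that F'(2) A_Om by (force simp: E_def J_def cell_def branches_iff)
    with F'(3) show "\<Inter>F \<noteq> {}"
      by blast
  qed
  ultimately have "\<Inter>(E ` (J \<times> UNIV)) \<noteq> {}"
    by (intro saturation)
  then obtain x where x: "\<And>j. j \<in> J \<times> UNIV \<Longrightarrow> x \<in> E j"
    by blast
  have x_cell: "x \<in> cell \<alpha> n" if "(\<alpha>, n) \<in> J" for \<alpha> n
  proof -
    have "x \<in> E ((\<alpha>, n), k)" for k
      using that x by blast
    then show ?thesis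
      by (simp add: E_def cell_def branches_iff)
  qed
  have "x \<in> K" if K: "K \<in> D" for K
  proof -
    obtain a n where an: "K = (\<Inter>i :: nat. cell (a i) (n i))" "range a \<subseteq> Field lam"
      using K D by (auto simp: family_def)
    have "K \<subseteq> cell (a i) (n i)" for i
      using an(1) by blast
    then have "(a i, n i) \<in> J" for i
      using K an(2) by (auto simp: J_def)
    then show ?thesis
      using x_cell an(1) by simp
  qed
  then show "\<Inter>D \<noteq> {}"
    by blast
qed

text \<open>Half of \<open>e\<close> is spent on a countable intersection of internal sets, the
  other half on passing from these sets to cells.\<close>

lemma family_inner_approximation:
  assumes S: "S \<in> sets loeb0" and e: "0 < (e :: real)"
  shows "\<exists>K\<in>family. K \<subseteq> S \<and> measure loeb0 S \<le> measure loeb0 K + e"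
proof -
  obtain B where B: "range B \<subseteq> star_Pow Om" "(\<Inter>i :: nat. B i) \<subseteq> S"
      "measure loeb0 S \<le> measure loeb0 (\<Inter>i. B i) + e / 2"
    using int.inner_approximation[OF loeb0.finite_measure_axioms space_loeb0 sets_loeb0 S, of "e / 2"] e
    by auto
  have "\<exists>\<alpha>\<in>Field lam. A \<alpha> = B i" for i
    using B(1) enum by (metis imageE rangeI subsetD)
  then obtain a where a: "\<And>i. a i \<in> Field lam" "\<And>i. A (a i) = B i"
    by metis
  \<comment> \<open>Summed over all \<open>i\<close>, these bounds on the losses amount to
    \<open>e / 2\<close>.\<close>
  have "\<exists>n. 1 / real (n + 1) \<le> e / 2 * (1 / 2) ^ Suc i" for i
    using reals_Archimedean[of "e / 2 * (1 / 2) ^ Suc i"] e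
    by (auto simp: inverse_eq_divide intro: less_imp_le)
  then obtain n where n: "\<And>i. 1 / real (n i + 1) \<le> e / 2 * (1 / 2) ^ Suc i"
    by metis
  define K where "K = (\<Inter>i. cell (a i) (n i))"
  have K: "K \<in> family"
    using a(1) by (auto simp: K_def family_def)
  have KB: "K \<subseteq> (\<Inter>i. B i)"
    using a(2) by (auto simp: K_def cell_def)
  have Bs: "B i \<in> sets loeb0" for i
    using B(1) star_Pow_sets by blast
  define R where "R i = B i - cell (a i) (n i)" for i
  have R: "range R \<subseteq> sets loeb0"
    using Bs cell_sets a(1) by (auto simp: R_def)
  have le: "measure loeb0 (R i) \<le> e / 2 * (1 / 2) ^ Suc i" for i
    using measure_Diff_cell[OF a(1), of i "n i"] n[of i] a(2)[of i] by (simp add: R_def)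
  have sums: "(\<lambda>i. e / 2 * (1 / 2) ^ Suc i) sums (e / 2)"
    using sums_mult[OF power_half_series, of "e / 2"] by simp
  have sR: "summable (\<lambda>i. measure loeb0 (R i))"
    by (rule summable_comparison_test[OF _ sums_summable[OF sums]]) (use le in auto)
  have "measure loeb0 ((\<Inter>i. B i) - K) \<le> measure loeb0 (\<Union>i. R i)"
    using R by (intro loeb0.finite_measure_mono) (auto simp: K_def R_def)
  also have "\<dots> \<le> (\<Sum>i. measure loeb0 (R i))"
    by (rule loeb0.finite_measure_subadditive_countably[OF R sR])
  also have "\<dots> \<le> e / 2"
    using suminf_le[OF le sR sums_summable[OF sums]] sums_unique[OF sums] by simp
  also have "measure loeb0 ((\<Inter>i. B i) - K) = measure loeb0 (\<Inter>i. B i) - measure loeb0 K"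
    using Bs KB K family_sets by (intro loeb0.finite_measure_Diff) auto
  finally show ?thesis
    using B K KB by (intro bexI[of _ K]) auto
qed

lemma compact_loeb: "compact_measure_space (loeb H)"
  unfolding compact_measure_space_def
proof (intro exI conjI)
  show "family \<subseteq> sets (loeb H)"
    using family_sets by (auto simp: loeb_eq)
  show "compact_family family"
    by (rule compact_family)
  show "inner_regular_family (loeb H) family"
    unfolding inner_regular_family_def
  proof (intro ballI antisym)
    fix S assume S: "S \<in> sets (loeb H)"
    show "(SUP K\<in>{K\<in>family. K \<subseteq> S}. emeasure (loeb H) K) \<le> emeasure (loeb H) S"
      using S by (intro SUP_least emeasure_mono) auto
    \<comment> \<open>A set of the completion contains a \<open>loeb0\<close>-measurable set of the
      same measure, so the approximation before completion suffices.\<close>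
    let ?S = "main_part loeb0 S"
    have S': "?S \<in> sets loeb0" "?S \<subseteq> S" "emeasure (loeb H) S = emeasure loeb0 ?S"
      using S main_part_sets[of S loeb0] main_part_null_part_Un[of S loeb0] unfolding loeb_eq
      by (blast, blast, simp)
    show "emeasure (loeb H) S \<le> (SUP K\<in>{K\<in>family. K \<subseteq> S}. emeasure (loeb H) K)"
    proof (rule ennreal_le_epsilon)
      fix e :: real assume "0 < e"
      then obtain K where K: "K \<in> family" "K \<subseteq> ?S" "measure loeb0 ?S \<le> measure loeb0 K + e"
        using family_inner_approximation[OF S'(1)] by blast
      then have "emeasure (loeb H) S \<le> emeasure loeb0 K + ennreal e"
        using \<open>0 < e\<close> unfolding S'(3) by (simp add: loeb0.emeasure_eq_measure flip: ennreal_plus)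
      also have "emeasure loeb0 K = emeasure (loeb H) K"
        using K(1) family_sets by (auto simp: loeb_eq)
      also have "emeasure (loeb H) K + ennreal e
          \<le> (SUP K\<in>{K\<in>family. K \<subseteq> S}. emeasure (loeb H) K) + ennreal e"
        using K S'(2) by (intro add_right_mono SUP_upper) auto
      finally show "emeasure (loeb H) S \<le> (SUP K\<in>{K\<in>family. K \<subseteq> S}. emeasure (loeb H) K) + ennreal e" .
    qed
  qed
qed

end

theorem theorem2:
  fixes \<kappa> :: "'k rel" and lam :: "'l rel" and T :: "'l \<Rightarrow> nat \<Rightarrow> bool list set"
    and mem :: "'v \<Rightarrow> 'v \<Rightarrow> bool" and num :: "nat \<Rightarrow> 'v"
    and smem :: "'w \<Rightarrow> 'w \<Rightarrow> bool" and star :: "'v \<Rightarrow> 'w" and H :: 'w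
  assumes "Card_order \<kappa>" and "natLeq <o \<kappa>"
    and "Card_order lam" and "natLeq <o lam"
    and "witness \<kappa> lam T"
    and "nonstandard_universe mem num smem star"
    and "elementary_extension.saturated mem num smem star \<kappa>"
    and "H \<in> elementary_extension.star_N mem num smem star
           - elementary_extension.standard_N num star"
    and "|elementary_extension.star_Pow mem num smem star
           (elementary_extension.hyperfinite mem num smem star H)| =o lam"
  shows "compact_measure_space (elementary_extension.loeb mem num smem star H)"
proof -
  interpret nonstandard_universe mem num smem star
    by fact
  have "|star_Pow (hyperfinite H)| =o |Field lam|"
    using assms(3,9) card_of_Field_ordIso ordIso_symmetric ordIso_transitive by metis
  \<comment> \<open>The internal subsets are indexed by \<open>Field lam\<close>, so that each is
    paired with a sequence of trees from the witness.\<close>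
  then obtain A where "bij_betw A (Field lam) (star_Pow (hyperfinite H))"
    using card_of_ordIso ordIso_symmetric by metis
  then interpret witnessed_space mem num smem star H \<kappa> lam T A
    by unfold_locales (use assms in \<open>auto simp: bij_betw_def\<close>)
  show ?thesis
    by (rule compact_loeb)
qed

end
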